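(* Let $\mathcal{R}$ be a von Neumann algebra. The projection lattice $\mathcal{P}(\mathcal{R})$ is of finite type if and only if $\mathcal{R}$ is a finite von Neumann algebra.
   Context: $\mathcal{P}(\mathcal{R})$ is the complete orthomodular lattice of orthogonal projections in $\mathcal{R}$ (order $P\le Q\iff PQ=P$). $\mathcal{R}$ is finite if its identity $I$ is a finite projection, i.e. there is no projection $E_0\in\mathcal{R}$ with $E_0<I$ and $E_0\sim I$ (Murray–von Neumann equivalence via a partial isometry in $\mathcal{R}$). A quasipoint in a lattice $\mathbb{L}$ with least element $0$ is a maximal (w.r.t. inclusion) subset $\mathfrak{B}\subseteq\mathbb{L}$ such that $\mathfrak{B}\neq\emptyset$, $0\notin\mathfrak{B}$, and for all $a,b\in\mathfrak{B}$ there is $c\in\mathfrak{B}$ with $c\le a\wedge b$. $\mathcal{Q}(\mathbb{L})$ denotes the set of quasipoints; for $a\in\mathbb{L}$ put $\mathcal{Q}_a(\mathbb{L})=\{\mathfrak{B}\in\mathcal{Q}(\mathbb{L}) : a\in\mathfrak{B}\}$. The Stone spectrum of $\mathbb{L}$ is $\mathcal{Q}(\mathbb{L})$ with the topology having the sets $\mathcal{Q}_a(\mathbb{L})$ as a basis. A complete lattice $\mathbb{L}$ is of finite type if $\overline{\bigcup_{k\in K}\mathcal{Q}_{a_k}(\mathbb{L})}=\mathcal{Q}_{\bigvee_{k\in K}a_k}(\mathbb{L})$ (closure in the Stone spectrum) for every increasing family $(a_k)_{k\in K}$, i.e. indexed by a directed set $K$ with $k\le l\Rightarrow a_k\le a_l$.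 *)

theory Defs
  imports "HOL-Analysis.Analysis"
begin

text \<open>A complex Hilbert space is encoded as a real Hilbert space (class
real_inner + complete_space) together with a complex structure J
(multiplication by the imaginary unit): J is bounded real-linear,
J (J x) = - x, and J preserves the real inner product. The complex inner
product is then inner x y + i inner x (J y) (up to convention), and the
bounded complex-linear operators are the bounded real-linear operators
commuting with J.\<close>

definition cplx_structure :: "('a::real_inner \<Rightarrow> 'a) \<Rightarrow> bool" where
  "cplx_structure J \<longleftrightarrow> bounded_linear J \<and> (\<forall>x. J (J x) = - x)
     \<and> (\<forall>x y. inner (J x) (J y) = inner x y)"

definition cbops :: "('a::real_inner \<Rightarrow> 'a) \<Rightarrow> ('a \<Rightarrow> 'a) set" where
  "cbops J = {T. bounded_linear T \<and> T \<circ> J = J \<circ> T}"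

definition is_adjoint :: "('a::real_inner \<Rightarrow> 'a) \<Rightarrow> ('a \<Rightarrow> 'a) \<Rightarrow> bool" where
  "is_adjoint T S \<longleftrightarrow> (\<forall>x y. inner (T x) y = inner x (S y))"

definition commutant :: "('a::real_inner \<Rightarrow> 'a) \<Rightarrow> ('a \<Rightarrow> 'a) set \<Rightarrow> ('a \<Rightarrow> 'a) set" where
  "commutant J M = {S \<in> cbops J. \<forall>T\<in>M. S \<circ> T = T \<circ> S}"

definition von_neumann_algebra ::
  "('a::{real_inner,complete_space} \<Rightarrow> 'a) \<Rightarrow> ('a \<Rightarrow> 'a) set \<Rightarrow> bool" where
  "von_neumann_algebra J M \<longleftrightarrow> cplx_structure J \<and> M \<subseteq> cbops J
     \<and> (\<forall>T\<in>M. \<exists>S\<in>M. is_adjoint T S)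
     \<and> commutant J (commutant J M) = M"

definition projections :: "('a::real_inner \<Rightarrow> 'a) set \<Rightarrow> ('a \<Rightarrow> 'a) set" where
  "projections M = {P \<in> M. P \<circ> P = P \<and> is_adjoint P P}"

definition proj_le :: "('a \<Rightarrow> 'a) \<Rightarrow> ('a \<Rightarrow> 'a) \<Rightarrow> bool" where
  "proj_le P Q \<longleftrightarrow> P \<circ> Q = P"

definition mvn_equiv :: "('a::real_inner \<Rightarrow> 'a) set \<Rightarrow> ('a \<Rightarrow> 'a) \<Rightarrow> ('a \<Rightarrow> 'a) \<Rightarrow> bool" where
  "mvn_equiv M P Q \<longleftrightarrow> (\<exists>V\<in>M. \<exists>W\<in>M. is_adjoint V W \<and> W \<circ> V = P \<and> V \<circ> W = Q)"

definition finite_vNa :: "('a::real_inner \<Rightarrow> 'a) set \<Rightarrow> bool" where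
  "finite_vNa M \<longleftrightarrow>
     \<not> (\<exists>E\<in>projections M. proj_le E id \<and> E \<noteq> id \<and> mvn_equiv M E id)"

definition lat_bot :: "'a set \<Rightarrow> ('a \<Rightarrow> 'a \<Rightarrow> bool) \<Rightarrow> 'a" where
  "lat_bot L le = (THE z. z \<in> L \<and> (\<forall>x\<in>L. le z x))"

definition lat_meet :: "'a set \<Rightarrow> ('a \<Rightarrow> 'a \<Rightarrow> bool) \<Rightarrow> 'a \<Rightarrow> 'a \<Rightarrow> 'a" where
  "lat_meet L le a b = (THE c. c \<in> L \<and> le c a \<and> le c b
       \<and> (\<forall>d\<in>L. le d a \<and> le d b \<longrightarrow> le d c))"

definition lat_Sup :: "'a set \<Rightarrow> ('a \<Rightarrow> 'a \<Rightarrow> bool) \<Rightarrow> 'a set \<Rightarrow> 'a" where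
  "lat_Sup L le S = (THE s. s \<in> L \<and> (\<forall>x\<in>S. le x s)
       \<and> (\<forall>u\<in>L. (\<forall>x\<in>S. le x u) \<longrightarrow> le s u))"

definition filter_base :: "'a set \<Rightarrow> ('a \<Rightarrow> 'a \<Rightarrow> bool) \<Rightarrow> 'a set \<Rightarrow> bool" where
  "filter_base L le B \<longleftrightarrow> B \<subseteq> L \<and> B \<noteq> {} \<and> lat_bot L le \<notin> B
     \<and> (\<forall>a\<in>B. \<forall>b\<in>B. \<exists>c\<in>B. le c (lat_meet L le a b))"

definition quasipoints :: "'a set \<Rightarrow> ('a \<Rightarrow> 'a \<Rightarrow> bool) \<Rightarrow> 'a set set" where
  "quasipoints L le = {B. filter_base L le B
      \<and> (\<forall>C. filter_base L le C \<and> B \<subseteq> C \<longrightarrow> C = B)}"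

definition Q_at :: "'a set \<Rightarrow> ('a \<Rightarrow> 'a \<Rightarrow> bool) \<Rightarrow> 'a \<Rightarrow> 'a set set" where
  "Q_at L le a = {B \<in> quasipoints L le. a \<in> B}"

definition stone_spectrum :: "'a set \<Rightarrow> ('a \<Rightarrow> 'a \<Rightarrow> bool) \<Rightarrow> 'a set topology" where
  "stone_spectrum L le = topology_generated_by (Q_at L le ` L)"

text \<open>Finite type: for every increasing family (a_k) indexed by a directed
(preordered, nonempty) set K, the closure of the union of the Q_{a_k} equals
Q of the join. Index sets are taken inside the carrier type 'a (no loss of
generality, since only the image of the family matters).\<close>
definition finite_type :: "'a set \<Rightarrow> ('a \<Rightarrow> 'a \<Rightarrow> bool) \<Rightarrow> bool" where
  "finite_type L le \<longleftrightarrow>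
    (\<forall>(K::'a set) (r::'a \<Rightarrow> 'a \<Rightarrow> bool) (a::'a \<Rightarrow> 'a).
       K \<noteq> {} \<and> (\<forall>k\<in>K. r k k) \<and> (\<forall>k\<in>K. \<forall>l\<in>K. \<forall>m\<in>K. r k l \<and> r l m \<longrightarrow> r k m)
       \<and> (\<forall>k\<in>K. \<forall>l\<in>K. \<exists>m\<in>K. r k m \<and> r l m)
       \<and> a ` K \<subseteq> L \<and> (\<forall>k\<in>K. \<forall>l\<in>K. r k l \<longrightarrow> le (a k) (a l))
       \<longrightarrow> stone_spectrum L le closure_of (\<Union>k\<in>K. Q_at L le (a k))
           = Q_at L le (lat_Sup L le (a ` K)))"

end

theory Submission
  imports Defs
begin

text \<open>
  Since quasipoints are maximal filter bases, finite type means: if \<open>a\<close> is the join of an increasing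
  family \<open>a\<^sub>k\<close> and \<open>0 \<noteq> b \<le> a\<close>, then \<open>b \<and> a\<^sub>k \<noteq> 0\<close> for some \<open>k\<close>.

  If the algebra is not finite, it contains a proper isometry \<open>W\<close>; the kernels of the powers of its adjoint
  increase, and the eigenspace of the adjoint for the eigenvalue \<open>1/2\<close> lies below their join but
  meets each of them trivially.

  Conversely, projections \<open>p\<close>, \<open>q\<close> for which \<open>q\<close> is injective on the range of \<open>p\<close> give a partial isometry
  from \<open>p\<close> into \<open>q\<close> (polar decomposition of \<open>q p\<close>). In a finite algebra this yields the modular law,
  with no comparison theory and no trace. If \<open>b \<and> a\<^sub>k = 0\<close> for all \<open>k\<close> and \<open>x = b x = a x\<close>, choose an
  increasing sequence \<open>d n\<close> in the family with \<open>d n x \<longlonglongrightarrow> x\<close>. By modularity each \<open>d (n + 1) - d n\<close> embeds into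
  \<open>(b \<or> d (n + 1)) - (b \<or> d n)\<close>, so the join of the \<open>d n\<close> embeds into itself with range
  orthogonal to its meet with \<open>b\<close>; finiteness forces this meet to vanish, hence \<open>x = 0\<close>.
\<close>

section \<open>Finite type in terms of joins and meets\<close>

text \<open>The link between the topology and the order needs no operators, so it is isolated here.
  Joins are asked for nonempty directed sets, the only ones that occur as images of increasing
  families.\<close>

locale directed_meet_poset =
  fixes L :: "'b set" and le :: "'b \<Rightarrow> 'b \<Rightarrow> bool" and z :: 'b
  assumes refl: "a \<in> L \<Longrightarrow> le a a"
    and trans: "a \<in> L \<Longrightarrow> b \<in> L \<Longrightarrow> c \<in> L \<Longrightarrow> le a b \<Longrightarrow> le b c \<Longrightarrow> le a c"
    and antisym: "a \<in> L \<Longrightarrow> b \<in> L \<Longrightarrow> le a b \<Longrightarrow> le b a \<Longrightarrow> a = b"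
    and z_in: "z \<in> L" and z_le: "a \<in> L \<Longrightarrow> le z a"
    and ex_meet: "a \<in> L \<Longrightarrow> b \<in> L \<Longrightarrow> \<exists>c\<in>L. le c a \<and> le c b \<and> (\<forall>d\<in>L. le d a \<and> le d b \<longrightarrow> le d c)"
    and ex_directed_Sup: "\<lbrakk>S \<subseteq> L; S \<noteq> {}; \<forall>a\<in>S. \<forall>b\<in>S. \<exists>c\<in>S. le a c \<and> le b c\<rbrakk>
       \<Longrightarrow> \<exists>s\<in>L. (\<forall>x\<in>S. le x s) \<and> (\<forall>u\<in>L. (\<forall>x\<in>S. le x u) \<longrightarrow> le s u)"
begin

section \<open>Meets, joins and filter bases\<close>

abbreviation "meet \<equiv> lat_meet L le"

lemma lat_bot_eq: "lat_bot L le = z"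
  unfolding lat_bot_def using z_in z_le antisym by (intro the_equality) auto

lemma meet_props:
  assumes "a \<in> L" "b \<in> L"
  shows meet_in: "meet a b \<in> L" and meet_le1: "le (meet a b) a" and meet_le2: "le (meet a b) b"
    and meet_greatest: "\<And>d. d \<in> L \<Longrightarrow> le d a \<Longrightarrow> le d b \<Longrightarrow> le d (meet a b)"
proof -
  obtain c where c: "c \<in> L" "le c a" "le c b" "\<forall>d\<in>L. le d a \<and> le d b \<longrightarrow> le d c"
    using ex_meet[OF assms] by blast
  have "meet a b = c"
    unfolding lat_meet_def using c antisym by (intro the_equality) blast+
  with c show "meet a b \<in> L" "le (meet a b) a" "le (meet a b) b"
    "\<And>d. d \<in> L \<Longrightarrow> le d a \<Longrightarrow> le d b \<Longrightarrow> le d (meet a b)" by auto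
qed

lemma lat_Sup_eqI:
  assumes "s \<in> L" "\<And>x. x \<in> S \<Longrightarrow> le x s" "\<And>u. u \<in> L \<Longrightarrow> (\<And>x. x \<in> S \<Longrightarrow> le x u) \<Longrightarrow> le s u"
  shows "lat_Sup L le S = s"
  unfolding lat_Sup_def using assms antisym by (intro the_equality) blast+

lemma le_z: "a \<in> L \<Longrightarrow> le a z \<Longrightarrow> a = z"
  using antisym z_in z_le by blast

text \<open>Lying below \<open>meet a b\<close> means lying below \<open>a\<close> and
  \<open>b\<close>; this frees later arguments from the description operator in
  \<open>lat_meet\<close>.\<close>

lemma filter_base_iff:
  "filter_base L le B \<longleftrightarrow> B \<subseteq> L \<and> B \<noteq> {} \<and> z \<notin> B \<and> (\<forall>a\<in>B. \<forall>b\<in>B. \<exists>c\<in>B. le c a \<and> le c b)"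
proof -
  have iff: "le c (meet a b) \<longleftrightarrow> le c a \<and> le c b" if "a \<in> L" "b \<in> L" "c \<in> L" for a b c
    using meet_props[OF that(1,2)] that trans by blast
  have "(\<forall>a\<in>B. \<forall>b\<in>B. \<exists>c\<in>B. le c (meet a b)) \<longleftrightarrow> (\<forall>a\<in>B. \<forall>b\<in>B. \<exists>c\<in>B. le c a \<and> le c b)"
    if "B \<subseteq> L"
    by (intro ball_cong bex_cong HOL.refl iff) (use that in auto)
  then show ?thesis
    unfolding filter_base_def lat_bot_eq by auto
qed

section \<open>Quasipoints as maximal filter bases\<close>

lemma quasipoint_filter_base: "B \<in> quasipoints L le \<Longrightarrow> filter_base L le B"
  by (simp add: quasipoints_def)

lemma quasipoint_subset: "B \<in> quasipoints L le \<Longrightarrow> B \<subseteq> L"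
  by (simp add: quasipoints_def filter_base_def)

lemma quasipoint_common_lower:
  assumes "B \<in> quasipoints L le" "a \<in> B" "b \<in> B"
  obtains c where "c \<in> B" "c \<in> L" "c \<noteq> z" "le c a" "le c b"
proof -
  have "B \<subseteq> L" "z \<notin> B" "\<exists>c\<in>B. le c a \<and> le c b"
    using assms quasipoint_filter_base[OF assms(1)] unfolding filter_base_iff by auto
  with that show thesis by blast
qed

text \<open>The elements above some \<open>meet a b\<close> with \<open>b\<close> in
  \<open>B\<close> form a filter base that contains \<open>B\<close> and \<open>a\<close>;
  maximality identifies it with \<open>B\<close>.\<close>

lemma quasipoint_memI:
  assumes B: "B \<in> quasipoints L le" and a: "a \<in> L" and ne: "\<And>b. b \<in> B \<Longrightarrow> meet a b \<noteq> z"
  shows "a \<in> B"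
proof -
  have fb: "B \<subseteq> L" "B \<noteq> {}" "\<And>b c. b \<in> B \<Longrightarrow> c \<in> B \<Longrightarrow> \<exists>d\<in>B. le d b \<and> le d c"
    using quasipoint_filter_base[OF B] unfolding filter_base_iff by auto
  define C where "C = {c \<in> L. \<exists>b\<in>B. le (meet a b) c}"
  have up: "meet a b \<in> C" if "b \<in> B" for b
    using that fb(1) meet_in[OF a] refl unfolding C_def by blast
  have "filter_base L le C"
    unfolding filter_base_iff
  proof (intro conjI ballI)
    show "C \<subseteq> L" by (auto simp: C_def)
    show "C \<noteq> {}" using up fb(2) by blast
    show "z \<notin> C" using le_z meet_in[OF a] ne fb(1) unfolding C_def by blast
    fix c1 c2 assume "c1 \<in> C" "c2 \<in> C"
    then obtain b1 b2 where b: "c1 \<in> L" "c2 \<in> L" "b1 \<in> B" "b2 \<in> B" "le (meet a b1) c1" "le (meet a b2) c2"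
      unfolding C_def by blast
    obtain d where d: "d \<in> B" "le d b1" "le d b2" using fb(3) b by blast
    have L: "d \<in> L" "b1 \<in> L" "b2 \<in> L" using d b fb by auto
    have "le (meet a d) (meet a b1)" "le (meet a d) (meet a b2)"
      using meet_props[OF a L(1)] meet_props[OF a L(2)] meet_props[OF a L(3)] trans L d by blast+
    then have "le (meet a d) c1" "le (meet a d) c2"
      using b L meet_in[OF a] trans by blast+
    then show "\<exists>c\<in>C. le c c1 \<and> le c c2" using up[OF d(1)] by blast
  qed
  moreover have "B \<subseteq> C" using fb(1) meet_le2[OF a] unfolding C_def by blast
  ultimately have "C = B" using B by (simp add: quasipoints_def)
  moreover have "a \<in> C" using fb(1,2) meet_le1[OF a] a unfolding C_def by blast
  ultimately show ?thesis by simp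
qed

lemma quasipoint_upward:
  assumes B: "B \<in> quasipoints L le" and a: "a \<in> B" and c: "c \<in> L" "le a c"
  shows "c \<in> B"
proof (rule quasipoint_memI[OF B c(1)])
  fix b assume b: "b \<in> B"
  obtain d where d: "d \<in> L" "d \<noteq> z" "le d a" "le d b"
    using quasipoint_common_lower[OF B a b] .
  have L: "a \<in> L" "b \<in> L" using quasipoint_subset[OF B] a b by auto
  have "le d (meet c b)" using meet_greatest[OF c(1) L(2) d(1)] trans[OF d(1) L(1) c(1)] d c by blast
  then show "meet c b \<noteq> z" using le_z d by blast
qed

text \<open>Zorn's lemma for the filter bases containing \<open>a\<close>: unions of nonempty chains
  are again such bases, and \<open>{a}\<close> bounds the empty chain.\<close>

lemma ex_quasipoint:
  assumes a: "a \<in> L" "a \<noteq> z"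
  obtains B where "B \<in> quasipoints L le" "a \<in> B"
proof -
  define \<A> where "\<A> = {B. filter_base L le B \<and> a \<in> B}"
  have fa: "{a} \<in> \<A>" using a refl by (auto simp: \<A>_def filter_base_iff)
  have "\<exists>U\<in>\<A>. \<forall>X\<in>\<C>. X \<subseteq> U" if C: "subset.chain \<A> \<C>" for \<C>
  proof (cases "\<C> = {}")
    case False
    have ch: "\<And>X. X \<in> \<C> \<Longrightarrow> X \<in> \<A>" "\<And>X Y. X \<in> \<C> \<Longrightarrow> Y \<in> \<C> \<Longrightarrow> X \<subseteq> Y \<or> Y \<subseteq> X"
      using C unfolding subset_chain_def by blast+
    have "\<exists>c\<in>\<Union>\<C>. le c u \<and> le c v" if uv: "u \<in> \<Union>\<C>" "v \<in> \<Union>\<C>" for u v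
    proof -
      obtain X where "X \<in> \<C>" "u \<in> X" "v \<in> X" using uv ch(2) by blast
      then show ?thesis using ch(1) unfolding \<A>_def filter_base_iff by blast
    qed
    then have "\<Union>\<C> \<in> \<A>"
      using ch(1) False unfolding \<A>_def filter_base_iff by blast
    then show ?thesis by blast
  qed (use fa in blast)
  from subset_Zorn[OF this] obtain B where B: "B \<in> \<A>" "\<forall>X\<in>\<A>. B \<subseteq> X \<longrightarrow> X = B"
    by blast
  then have "B \<in> quasipoints L le" "a \<in> B"
    unfolding \<A>_def quasipoints_def by auto
  with that show thesis .
qed

section \<open>The Stone topology and closures of unions of basic sets\<close>

lemma openin_Q_at: "b \<in> L \<Longrightarrow> openin (stone_spectrum L le) (Q_at L le b)"
  by (auto simp: stone_spectrum_def openin_topology_generated_by_iff intro: generate_topology_on.Basis)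

lemma topspace_stone_spectrum: "topspace (stone_spectrum L le) = quasipoints L le"
proof -
  have "\<Union>(Q_at L le ` L) = quasipoints L le"
  proof (intro equalityI subsetI)
    fix B assume B: "B \<in> quasipoints L le"
    then obtain a where "a \<in> B" using quasipoint_filter_base unfolding filter_base_def by blast
    then show "B \<in> \<Union>(Q_at L le ` L)" using B quasipoint_subset[OF B] unfolding Q_at_def by blast
  qed (auto simp: Q_at_def)
  then show ?thesis by (simp add: stone_spectrum_def topology_generated_by_topspace)
qed

text \<open>\<open>topology_generated_by\<close> treats the sets \<open>Q_at\<close> as a subbasis.
  They are a basis, because two members of a quasipoint have a lower bound in it and quasipoints are
  upward closed.\<close>

lemma stone_spectrum_nhd:
  assumes "openin (stone_spectrum L le) U" "B \<in> U"
  obtains b where "b \<in> B" "Q_at L le b \<subseteq> U"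
proof -
  have B: "B \<in> quasipoints L le"
    using assms openin_subset topspace_stone_spectrum by blast
  have "generate_topology_on (Q_at L le ` L) U"
    using assms by (simp add: stone_spectrum_def openin_topology_generated_by_iff)
  then have "B \<in> U \<longrightarrow> (\<exists>b\<in>B. Q_at L le b \<subseteq> U)"
  proof induction
    case (Int U V)
    show ?case
    proof
      assume "B \<in> U \<inter> V"
      then obtain u v where uv: "u \<in> B" "v \<in> B" "Q_at L le u \<subseteq> U" "Q_at L le v \<subseteq> V"
        using Int by blast
      obtain c where c: "c \<in> B" "le c u" "le c v"
        using quasipoint_common_lower[OF B uv(1,2)] .
      have "u \<in> L" "v \<in> L" using quasipoint_subset[OF B] uv by auto
      then have "Q_at L le c \<subseteq> Q_at L le u \<inter> Q_at L le v"
        using quasipoint_upward c unfolding Q_at_def by blast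
      then show "\<exists>b\<in>B. Q_at L le b \<subseteq> U \<inter> V" using uv c by blast
    qed
  next
    case (UN \<U>)
    show ?case
    proof
      assume "B \<in> \<Union>\<U>"
      then obtain X where X: "X \<in> \<U>" "B \<in> X" by blast
      then obtain b where "b \<in> B" "Q_at L le b \<subseteq> X" using UN by blast
      then show "\<exists>b\<in>B. Q_at L le b \<subseteq> \<Union>\<U>" using X by blast
    qed
  qed (auto simp: Q_at_def)
  with assms that show thesis by blast
qed

text \<open>Two basic sets intersect exactly when their labels have nonzero meet, so membership in
  the closure is a condition on meets with the \<open>a k\<close>.\<close>

lemma closure_of_Union_Q_at_iff:
  assumes "a ` K \<subseteq> L" "s \<in> L" "\<And>k. k \<in> K \<Longrightarrow> le (a k) s"
  shows "stone_spectrum L le closure_of (\<Union>k\<in>K. Q_at L le (a k)) = Q_at L le s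
    \<longleftrightarrow> (\<forall>b\<in>L. le b s \<and> b \<noteq> z \<longrightarrow> (\<exists>k\<in>K. meet b (a k) \<noteq> z))" (is "?cl = _ \<longleftrightarrow> ?R")
proof
  have aL: "a k \<in> L" if "k \<in> K" for k using assms that by blast
  have meetne: "meet b c \<noteq> z" if B: "B \<in> quasipoints L le" "b \<in> B" "c \<in> B" for B b c
  proof -
    obtain d where d: "d \<in> L" "d \<noteq> z" "le d b" "le d c"
      using quasipoint_common_lower[OF B] .
    have "b \<in> L" "c \<in> L" using quasipoint_subset[OF B(1)] B by auto
    then show ?thesis using meet_greatest[of b c d] le_z d by metis
  qed
  {
    assume eq: "?cl = Q_at L le s"
    show ?R
    proof (intro ballI impI, elim conjE)
      fix b assume b: "b \<in> L" "le b s" "b \<noteq> z"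
      obtain B where B: "B \<in> quasipoints L le" "b \<in> B" using ex_quasipoint[OF b(1,3)] .
      then have "B \<in> ?cl" using quasipoint_upward[OF B assms(2) b(2)] eq by (simp add: Q_at_def)
      moreover have "B \<in> Q_at L le b" using B by (simp add: Q_at_def)
      ultimately obtain C where "C \<in> (\<Union>k\<in>K. Q_at L le (a k))" "C \<in> Q_at L le b"
        using openin_Q_at[OF b(1)] unfolding in_closure_of by meson
      then obtain k where "k \<in> K" "C \<in> quasipoints L le" "a k \<in> C" "b \<in> C"
        unfolding Q_at_def by blast
      then show "\<exists>k\<in>K. meet b (a k) \<noteq> z" using meetne by blast
    qed
  }
  assume R: ?R
  show "?cl = Q_at L le s"
  proof (intro equalityI subsetI)
    \<comment> \<open>Basic sets are closed: every \<open>b\<close> in \<open>B\<close> shares a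
      quasipoint with some \<open>a k\<close>, hence with \<open>s\<close>, and
      \<open>quasipoint_memI\<close> puts \<open>s\<close> into \<open>B\<close>.\<close>
    fix B assume cl: "B \<in> ?cl"
    then have B: "B \<in> quasipoints L le"
      using topspace_stone_spectrum unfolding in_closure_of by blast
    have "s \<in> B"
    proof (rule quasipoint_memI[OF B assms(2)])
      fix b assume b: "b \<in> B"
      then have bL: "b \<in> L" using quasipoint_subset[OF B] by blast
      have "B \<in> Q_at L le b" using B b by (simp add: Q_at_def)
      then obtain C where "C \<in> (\<Union>k\<in>K. Q_at L le (a k))" "C \<in> Q_at L le b"
        using cl openin_Q_at[OF bL] unfolding in_closure_of by meson
      then obtain k where C: "k \<in> K" "C \<in> quasipoints L le" "a k \<in> C" "b \<in> C"
        unfolding Q_at_def by blast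
      then have "s \<in> C" using quasipoint_upward assms by blast
      then show "meet s b \<noteq> z" using meetne C by blast
    qed
    then show "B \<in> Q_at L le s" using B by (simp add: Q_at_def)
  next
    fix B assume "B \<in> Q_at L le s"
    then have B: "B \<in> quasipoints L le" "s \<in> B" by (auto simp: Q_at_def)
    have "\<exists>C. C \<in> (\<Union>k\<in>K. Q_at L le (a k)) \<and> C \<in> U" if U: "B \<in> U \<and> openin (stone_spectrum L le) U" for U
    proof -
      obtain b where b: "b \<in> B" "Q_at L le b \<subseteq> U" using stone_spectrum_nhd U by blast
      \<comment> \<open>The condition speaks of elements below \<open>s\<close> only, so it is
        applied to a nonzero \<open>c\<close> below both \<open>b\<close> and
        \<open>s\<close>.\<close>
      obtain c where c: "c \<in> L" "c \<noteq> z" "le c b" "le c s"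
        using quasipoint_common_lower[OF B(1) b(1) B(2)] .
      then obtain k where k: "k \<in> K" "meet c (a k) \<noteq> z" using R by blast
      note m = meet_props[OF c(1) aL[OF k(1)]]
      obtain C where C: "C \<in> quasipoints L le" "meet c (a k) \<in> C"
        using ex_quasipoint[OF m(1) k(2)] .
      have bL: "b \<in> L" using quasipoint_subset B b by blast
      have "a k \<in> C" "b \<in> C"
        using quasipoint_upward[OF C] m aL[OF k(1)] bL trans[OF m(1) c(1) bL] c by blast+
      then show ?thesis using C k b unfolding Q_at_def by blast
    qed
    then show "B \<in> ?cl" using B topspace_stone_spectrum unfolding in_closure_of by blast
  qed
qed

section \<open>Finite type without the topology\<close>

lemma finite_typeI:
  assumes "\<And>S s b. \<lbrakk>S \<subseteq> L; S \<noteq> {}; \<forall>a\<in>S. \<forall>b\<in>S. \<exists>c\<in>S. le a c \<and> le b c;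
      s \<in> L; \<forall>x\<in>S. le x s; \<forall>u\<in>L. (\<forall>x\<in>S. le x u) \<longrightarrow> le s u;
      b \<in> L; le b s; b \<noteq> z\<rbrakk> \<Longrightarrow> \<exists>a\<in>S. meet b a \<noteq> z"
  shows "finite_type L le"
  unfolding finite_type_def
proof (intro allI impI, elim conjE)
  fix K :: "'b set" and r and a :: "'b \<Rightarrow> 'b"
  assume K: "K \<noteq> {}" "\<forall>k\<in>K. \<forall>l\<in>K. \<exists>m\<in>K. r k m \<and> r l m" "a ` K \<subseteq> L"
    "\<forall>k\<in>K. \<forall>l\<in>K. r k l \<longrightarrow> le (a k) (a l)"
  have dir: "\<forall>x\<in>a ` K. \<forall>y\<in>a ` K. \<exists>c\<in>a ` K. le x c \<and> le y c"
  proof (clarsimp)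
    fix k l assume kl: "k \<in> K" "l \<in> K"
    then obtain m where "m \<in> K" "r k m" "r l m" using K(2) by meson
    then show "\<exists>m\<in>K. le (a k) (a m) \<and> le (a l) (a m)" using K(4) kl by meson
  qed
  obtain s where s: "s \<in> L" "\<forall>x\<in>a ` K. le x s" "\<forall>u\<in>L. (\<forall>x\<in>a ` K. le x u) \<longrightarrow> le s u"
    using ex_directed_Sup[OF K(3) _ dir] K(1) by blast
  have "lat_Sup L le (a ` K) = s" using s by (intro lat_Sup_eqI) auto
  moreover have "stone_spectrum L le closure_of (\<Union>k\<in>K. Q_at L le (a k)) = Q_at L le s"
  proof (subst closure_of_Union_Q_at_iff)
    show "\<forall>b\<in>L. le b s \<and> b \<noteq> z \<longrightarrow> (\<exists>k\<in>K. meet b (a k) \<noteq> z)"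
      using assms[OF K(3) _ dir s] K(1) by blast
  qed (use K s in auto)
  ultimately show "stone_spectrum L le closure_of (\<Union>k\<in>K. Q_at L le (a k)) = Q_at L le (lat_Sup L le (a ` K))"
    by simp
qed

lemma finite_typeD:
  assumes ft: "finite_type L le"
    and S: "S \<subseteq> L" "S \<noteq> {}" "\<forall>a\<in>S. \<forall>b\<in>S. \<exists>c\<in>S. le a c \<and> le b c"
    and s: "s \<in> L" "\<forall>x\<in>S. le x s" "\<forall>u\<in>L. (\<forall>x\<in>S. le x u) \<longrightarrow> le s u"
    and b: "b \<in> L" "le b s" "b \<noteq> z"
  shows "\<exists>a\<in>S. meet b a \<noteq> z"
proof -
  have tr: "\<forall>k\<in>S. \<forall>l\<in>S. \<forall>m\<in>S. le k l \<and> le l m \<longrightarrow> le k m"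
    using S(1) trans by (meson subsetD)
  have "lat_Sup L le S = s" using s by (intro lat_Sup_eqI) auto
  \<comment> \<open>The directed set indexes itself: index order \<open>le\<close>, identity
    family.\<close>
  moreover have "stone_spectrum L le closure_of (\<Union>k\<in>S. Q_at L le k) = Q_at L le (lat_Sup L le ((\<lambda>x. x) ` S))"
  proof (rule ft[unfolded finite_type_def, THEN spec[of _ S], THEN spec[of _ le], THEN spec[of _ "\<lambda>x. x"], THEN mp],
      intro conjI)
    show "\<forall>k\<in>S. le k k" using S(1) refl by blast
    show "(\<lambda>x. x) ` S \<subseteq> L" using S(1) by simp
  qed (fact S(2), fact tr, fact S(3), simp)
  ultimately have "stone_spectrum L le closure_of (\<Union>k\<in>S. Q_at L le k) = Q_at L le s" by simp
  then show ?thesis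
    using closure_of_Union_Q_at_iff[of "\<lambda>x. x" S s, unfolded image_ident, OF S(1) s(1) s(2)[rule_format], THEN iffD1,
        THEN bspec, OF _ _ b(1), THEN mp] b by simp
qed

end

section \<open>Positive contractions\<close>

text \<open>\<open>\<phi>\<close> is an increasing bounded potential. Indices whose potential is
  within \<open>(1 / Suc n)\<^sup>2\<close> of the supremum give a Cauchy sequence, since two of
  them are compared through a common upper index; its limit attracts the whole net. For projections
  the potential is the squared norm.\<close>

lemma convergent_of_square_increments:
  fixes X :: "'i \<Rightarrow> 'a::{real_normed_vector,complete_space}" and \<phi> :: "'i \<Rightarrow> real"
  assumes ne: "C \<noteq> {}" and dir: "\<And>i j. i \<in> C \<Longrightarrow> j \<in> C \<Longrightarrow> \<exists>k\<in>C. r i k \<and> r j k"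
    and incr: "\<And>i j. i \<in> C \<Longrightarrow> j \<in> C \<Longrightarrow> r i j \<Longrightarrow> (norm (X j - X i))\<^sup>2 \<le> \<phi> j - \<phi> i"
    and bd: "\<And>i. i \<in> C \<Longrightarrow> \<phi> i \<le> B"
  shows "\<exists>l. \<forall>e>0. \<exists>i\<in>C. \<forall>j\<in>C. r i j \<longrightarrow> norm (X j - l) < e"
proof -
  define s where "s = (SUP i\<in>C. \<phi> i)"
  have bdd: "bdd_above (\<phi> ` C)" using bd by (auto simp: bdd_above_def)
  have le_s: "\<phi> i \<le> s" if "i \<in> C" for i
    unfolding s_def using bdd that by (rule cSUP_upper2) simp
  have "\<exists>i\<in>C. s - (1 / Suc n)\<^sup>2 < \<phi> i" for n
    using less_cSUP_iff[OF ne bdd, of "s - (1 / Suc n)\<^sup>2"] by (simp add: s_def[symmetric])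
  then obtain i where i: "\<And>n. i n \<in> C" "\<And>n. s - (1 / Suc n)\<^sup>2 < \<phi> (i n)" by metis
  have tail: "norm (X j - X (i n)) \<le> 1 / Suc n" if "j \<in> C" "r (i n) j" for n j
  proof (rule power2_le_imp_le)
    show "(norm (X j - X (i n)))\<^sup>2 \<le> (1 / Suc n)\<^sup>2"
      using incr[OF i(1) that] i(2)[of n] le_s[OF that(1)] by linarith
  qed simp
  have near: "norm (X (i m) - X (i n)) \<le> 1 / Suc m + 1 / Suc n" for m n
  proof -
    obtain k where k: "k \<in> C" "r (i m) k" "r (i n) k" using dir i(1) by meson
    have "norm (X (i m) - X (i n)) \<le> norm (X (i m) - X k) + norm (X k - X (i n))"
      using norm_triangle_ineq[of "X (i m) - X k" "X k - X (i n)"] by simp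
    with tail[OF k(1,2)] tail[OF k(1,3)] show ?thesis by (simp add: norm_minus_commute)
  qed
  have "Cauchy (\<lambda>n. X (i n))"
  proof (rule CauchyI)
    fix e :: real assume "e > 0"
    then obtain N where N: "1 / Suc N < e / 2" using nat_approx_posE[of "e/2"] by auto
    have "norm (X (i m) - X (i n)) < e" if "m \<ge> N" "n \<ge> N" for m n
    proof -
      have "1 / real (Suc m) \<le> 1 / Suc N" "1 / real (Suc n) \<le> 1 / Suc N"
        using that by (auto simp: frac_le)
      with near[of m n] N show ?thesis by linarith
    qed
    then show "\<exists>N. \<forall>m\<ge>N. \<forall>n\<ge>N. norm (X (i m) - X (i n)) < e" by blast
  qed
  then obtain l where l: "(\<lambda>n. X (i n)) \<longlonglongrightarrow> l" using Cauchy_convergent convergentD by blast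
  have "\<exists>i\<in>C. \<forall>j\<in>C. r i j \<longrightarrow> norm (X j - l) < e" if e: "e > 0" for e
  proof -
    obtain N1 where N1: "\<And>n. n \<ge> N1 \<Longrightarrow> norm (X (i n) - l) < e / 2"
      using LIMSEQ_D[OF l, of "e/2"] e by auto
    obtain N2 where N2: "1 / Suc N2 < e / 2" using nat_approx_posE[of "e/2"] e by auto
    define n where "n = max N1 N2"
    have n: "1 / real (Suc n) \<le> 1 / Suc N2" "n \<ge> N1" by (auto simp: n_def frac_le)
    have "norm (X j - l) < e" if j: "j \<in> C" "r (i n) j" for j
    proof -
      have "norm (X j - l) \<le> norm (X j - X (i n)) + norm (X (i n) - l)"
        using norm_triangle_ineq[of "X j - X (i n)" "X (i n) - l"] by simp
      with tail[OF j] N1[OF n(2)] n(1) N2 show ?thesis by linarith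
    qed
    then show ?thesis using i(1) by blast
  qed
  then show ?thesis by blast
qed

lemma convergent_of_square_increments_seq:
  fixes X :: "nat \<Rightarrow> 'a::{real_normed_vector,complete_space}" and \<phi> :: "nat \<Rightarrow> real"
  assumes "\<And>m n. m \<le> n \<Longrightarrow> (norm (X n - X m))\<^sup>2 \<le> \<phi> n - \<phi> m" and "\<And>n. \<phi> n \<le> B"
  shows "convergent X"
proof -
  obtain l where l: "\<forall>e>0. \<exists>i. \<forall>j\<ge>i. norm (X j - l) < e"
    using convergent_of_square_increments[of UNIV "(\<le>)" X \<phi> B] assms by auto (metis nat_le_linear)
  then show ?thesis by (auto simp: convergent_def LIMSEQ_iff)
qed

section \<open>The binomial series of exponent -1/2\<close>

text \<open>The Taylor coefficients of \<open>(1 - t) powr (- 1/2)\<close>; the square of that series is the geometric series.\<close>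

definition isq :: "nat \<Rightarrow> real" where "isq n = pochhammer (1/2) n / fact n"

lemma isq_nonneg: "0 \<le> isq n"
  by (simp add: isq_def pochhammer_nonneg)

text \<open>Up to sign these are binomial coefficients of exponent -1/2; by Vandermonde they
  convolve to those of exponent -1, which are \<open>(-1) ^ n\<close>.\<close>

lemma isq_convolution: "(\<Sum>i\<le>n. isq i * isq (n - i)) = 1"
proof -
  have c: "isq k = (-1) ^ k * ((-1/2) gchoose k)" for k
    using gbinomial_pochhammer[of "-1/2 :: real" k] by (simp add: isq_def)
  have "(\<Sum>i\<le>n. isq i * isq (n - i)) = (\<Sum>i\<le>n. (-1) ^ n * (((-1/2 :: real) gchoose i) * ((-1/2) gchoose (n - i))))"
  proof (rule sum.cong)
    fix i assume "i \<in> {..n}"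
    then have "(-1 :: real) ^ n = (-1) ^ i * (-1) ^ (n - i)" by (simp flip: power_add)
    then show "isq i * isq (n - i) = (-1) ^ n * (((-1/2 :: real) gchoose i) * ((-1/2) gchoose (n - i)))"
      by (simp add: c)
  qed simp
  also have "\<dots> = (-1) ^ n * ((-1/2 + -1/2 :: real) gchoose n)"
    by (simp only: gbinomial_Vandermonde sum_distrib_left[symmetric] atLeast0AtMost[symmetric])
  also have "\<dots> = 1"
    using gbinomial_pochhammer[of "-1 :: real" n] by (simp add: pochhammer_fact[symmetric])
  finally show ?thesis .
qed

section \<open>Powers and moments of an operator between 0 and 1\<close>

locale positive_contraction =
  fixes D :: "'a::{real_inner,complete_space} \<Rightarrow> 'a"
  assumes lin: "linear D"
    and sym: "inner (D x) y = inner x (D y)"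
    and nonneg: "0 \<le> inner (D x) x"
    and le_one: "inner (D x) x \<le> inner x x"
begin

lemma funpow_sym: "inner ((D ^^ n) x) y = inner x ((D ^^ n) y)"
  by (induction n arbitrary: x y) (simp_all add: sym funpow_swap1)

definition moment :: "'a \<Rightarrow> nat \<Rightarrow> real" where "moment x n = inner ((D ^^ n) x) x"

lemma inner_funpow: "inner ((D ^^ m) x) ((D ^^ n) x) = moment x (m + n)"
proof -
  have "inner ((D ^^ m) x) ((D ^^ n) x) = inner ((D ^^ n) ((D ^^ m) x)) x" by (simp add: funpow_sym)
  also have "(D ^^ n) ((D ^^ m) x) = (D ^^ (m + n)) x" by (simp add: add.commute[of m] funpow_add)
  finally show ?thesis by (simp add: moment_def)
qed

text \<open>\<open>D - D\<^sup>2 = (1 - D) D (1 - D) + D (1 - D) D\<close> is a sum of two positive operators.\<close>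

lemma inner_square_le: "inner (D x) (D x) \<le> inner (D x) x"
proof -
  have "inner (D x) x - inner (D x) (D x)
      = inner (D (x - D x)) (x - D x) + (inner (D x) (D x) - inner (D (D x)) (D x))"
    by (simp add: linear_diff[OF lin] inner_diff_left inner_diff_right sym)
  with nonneg[of "x - D x"] le_one[of "D x"] show ?thesis by linarith
qed

lemma norm_D_le: "norm (D x) \<le> norm x"
  using inner_square_le[of x] le_one[of x] by (simp add: norm_le)

lemma norm_funpow_le: "norm ((D ^^ n) x) \<le> norm x"
  by (induction n) (auto intro: order_trans[OF norm_D_le])

text \<open>For \<open>n = 2k\<close> this is \<open>D \<le> 1\<close> at the vector
  \<open>(D ^^ k) x\<close>, for \<open>n = 2k + 1\<close> it is \<open>D\<^sup>2 \<le> D\<close>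
  there.\<close>

lemma moment_Suc_le: "moment x (Suc n) \<le> moment x n"
proof (cases "even n")
  case True
  then obtain k where "n = k + k" by (metis evenE mult_2)
  then show ?thesis
    using le_one[of "(D ^^ k) x"] inner_funpow[of k x k] inner_funpow[of "Suc k" x k] by simp
next
  case False
  then obtain k where "n = Suc k + k" by (metis oddE mult_2 Suc_eq_plus1 add_Suc)
  then show ?thesis
    using inner_square_le[of "(D ^^ k) x"] inner_funpow[of "Suc k" x k] inner_funpow[of "Suc k" x "Suc k"] by simp
qed

lemma moment_nonneg: "0 \<le> moment x n"
proof (cases "even n")
  case True
  then obtain k where "n = k + k" by (metis evenE mult_2)
  then show ?thesis using inner_funpow[of k x k] by (metis inner_ge_zero)
next
  case False
  then obtain k where "n = Suc k + k" by (metis oddE mult_2 Suc_eq_plus1 add_Suc)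
  then show ?thesis
    using nonneg[of "(D ^^ k) x"] inner_funpow[of "Suc k" x k] by simp
qed

lemma moment_antimono: "m \<le> n \<Longrightarrow> moment x n \<le> moment x m"
  using lift_Suc_antimono_le[of "moment x"] moment_Suc_le by blast

section \<open>The projection onto the fixed vectors as a strong limit of powers\<close>

definition fixproj :: "'a \<Rightarrow> 'a" where "fixproj x = lim (\<lambda>n. (D ^^ n) x)"

text \<open>The squared distance of two powers is
  \<open>moment x (2 * n) - 2 * moment x (m + n) + moment x (2 * m)\<close>. Since moments decrease,
  minus the moment of order \<open>2 * n\<close> serves as the increasing potential.\<close>

lemma funpow_tendsto_fixproj: "(\<lambda>n. (D ^^ n) x) \<longlonglongrightarrow> fixproj x"
proof -
  have "convergent (\<lambda>n. (D ^^ n) x)"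
  proof (rule convergent_of_square_increments_seq)
    fix m n :: nat assume "m \<le> n"
    have "(norm ((D ^^ n) x - (D ^^ m) x))\<^sup>2
        = moment x (n + n) - moment x (n + m) - (moment x (m + n) - moment x (m + m))"
      by (simp only: power2_norm_eq_inner inner_diff_left inner_diff_right inner_funpow)
    then show "(norm ((D ^^ n) x - (D ^^ m) x))\<^sup>2 \<le> - moment x (n + n) - - moment x (m + m)"
      using moment_antimono[of "m + n" "n + n" x] moment_antimono[of "n + m" "n + n" x] \<open>m \<le> n\<close> by simp
  next
    fix n show "- moment x (n + n) \<le> 0" by (simp add: moment_nonneg)
  qed
  then show ?thesis by (simp add: fixproj_def convergent_LIMSEQ_iff)
qed

lemma D_fixproj: "D (fixproj x) = fixproj x"
proof -
  have "bounded_linear D"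
    using lin norm_D_le by (intro bounded_linear_intro[where K = 1]) (auto simp: linear_add linear_scale)
  then have "(\<lambda>n. D ((D ^^ n) x)) \<longlonglongrightarrow> D (fixproj x)"
    by (rule bounded_linear.tendsto) (rule funpow_tendsto_fixproj)
  moreover have "(\<lambda>n. D ((D ^^ n) x)) \<longlonglongrightarrow> fixproj x"
    using LIMSEQ_Suc[OF funpow_tendsto_fixproj[of x]] by simp
  ultimately show ?thesis by (rule LIMSEQ_unique)
qed

lemma fixproj_fixed: "D x = x \<Longrightarrow> fixproj x = x"
proof -
  assume "D x = x"
  then have "(D ^^ n) x = x" for n by (induction n) auto
  then show ?thesis by (simp add: fixproj_def)
qed

lemma fixproj_sym: "inner (fixproj x) y = inner x (fixproj y)"
proof -
  have "(\<lambda>n. inner ((D ^^ n) x) y) \<longlonglongrightarrow> inner (fixproj x) y"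
    by (intro tendsto_intros funpow_tendsto_fixproj)
  moreover have "(\<lambda>n. inner ((D ^^ n) x) y) \<longlonglongrightarrow> inner x (fixproj y)"
    unfolding funpow_sym by (intro tendsto_intros funpow_tendsto_fixproj)
  ultimately show ?thesis by (rule LIMSEQ_unique)
qed

lemma moment_tendsto: "moment x \<longlonglongrightarrow> inner (fixproj x) x"
  unfolding moment_def by (intro tendsto_intros funpow_tendsto_fixproj)

section \<open>Partial sums for the inverse square root of \<open>1 - D\<close>\<close>

definition isq_poly :: "nat \<Rightarrow> 'a \<Rightarrow> 'a" where
  "isq_poly n x = (\<Sum>i\<le>n. isq i *\<^sub>R (D ^^ i) x)"

text \<open>The form of \<open>1 - D\<close> on the partial sums becomes a sum of nonnegative terms,
  so the later estimates reduce to inclusions of index sets.\<close>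

lemma gram_isq_poly:
  "inner (isq_poly m x - D (isq_poly m x)) (isq_poly n x)
    = (\<Sum>(i,j)\<in>{..m}\<times>{..n}. isq i * isq j * (moment x (i + j) - moment x (Suc (i + j))))"
proof -
  have "isq_poly m x - D (isq_poly m x) = (\<Sum>i\<le>m. isq i *\<^sub>R ((D ^^ i) x - (D ^^ Suc i) x))"
    by (simp add: isq_poly_def linear_sum[OF lin] linear_scale[OF lin] scaleR_diff_right sum_subtractf)
  then have "inner (isq_poly m x - D (isq_poly m x)) (isq_poly n x)
     = (\<Sum>i\<le>m. \<Sum>j\<le>n. isq i * isq j * inner ((D ^^ i) x - (D ^^ Suc i) x) ((D ^^ j) x))"
    by (simp only: isq_poly_def inner_sum_left) (simp add: inner_sum_right sum_distrib_left mult_ac)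
  also have "\<dots> = (\<Sum>i\<le>m. \<Sum>j\<le>n. isq i * isq j * (moment x (i + j) - moment x (Suc (i + j))))"
    by (simp add: inner_diff_left inner_funpow inner_funpow[of "Suc _", simplified])
  finally show ?thesis by (simp add: sum.cartesian_product)
qed

text \<open>On each diagonal \<open>i + j = k\<close> the weights add up to 1 by
  \<open>isq_convolution\<close>; what remains telescopes.\<close>

lemma gram_triangle:
  "(\<Sum>(i,j)\<in>{(i,j). i + j \<le> n}. isq i * isq j * (moment x (i + j) - moment x (Suc (i + j))))
    = inner x x - moment x (Suc n)"
proof -
  have "(\<Sum>(i,j)\<in>{(i,j). i + j \<le> n}. isq i * isq j * (moment x (i + j) - moment x (Suc (i + j))))
     = (\<Sum>k\<le>n. \<Sum>i\<le>k. isq i * isq (k - i) * (moment x (i + (k - i)) - moment x (Suc (i + (k - i)))))"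
    by (rule sum.triangle_reindex_eq)
  also have "\<dots> = (\<Sum>k\<le>n. (\<Sum>i\<le>k. isq i * isq (k - i)) * (moment x k - moment x (Suc k)))"
    by (intro sum.cong refl) (simp add: sum_distrib_right)
  also have "\<dots> = (\<Sum>k\<le>n. moment x k - moment x (Suc k))" by (simp add: isq_convolution)
  also have "\<dots> = moment x 0 - moment x (Suc n)" by (rule sum_telescope)
  finally show ?thesis by (simp add: moment_def)
qed

lemma gram_term_nonneg: "0 \<le> isq i * isq j * (moment x (i + j) - moment x (Suc (i + j)))"
  by (simp add: isq_nonneg moment_Suc_le)

lemma gram_mono:
  assumes "m \<le> n"
  shows "inner (isq_poly m x - D (isq_poly m x)) (isq_poly m x)
     \<le> inner (isq_poly n x - D (isq_poly n x)) (isq_poly m x)"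
  unfolding gram_isq_poly using assms gram_term_nonneg
  by (intro sum_mono2) auto

lemma finite_triangle: "finite {(i, j). i + j \<le> (n::nat)}"
  by (rule finite_subset[of _ "{..n} \<times> {..n}"]) auto

text \<open>The square \<open>{..n} \<times> {..n}\<close> lies between the triangles
  \<open>i + j \<le> n\<close> and \<open>i + j \<le> 2 * n\<close>.\<close>

lemma gram_bounds:
  shows "inner x x - moment x (Suc n) \<le> inner (isq_poly n x - D (isq_poly n x)) (isq_poly n x)"
    and "inner (isq_poly n x - D (isq_poly n x)) (isq_poly n x) \<le> inner x x - moment x (Suc (2 * n))"
  unfolding gram_isq_poly gram_triangle[symmetric] using gram_term_nonneg finite_triangle
  by (intro sum_mono2; auto)+

end

section \<open>The projection lattice of a von Neumann algebra\<close>

locale von_neumann =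
  fixes J :: "'a::{real_inner,complete_space} \<Rightarrow> 'a" and M :: "('a \<Rightarrow> 'a) set"
  assumes vN: "von_neumann_algebra J M"
begin

section \<open>Membership through the bicommutant, and strong limits\<close>

lemma mem_bounded_linear: "T \<in> M \<Longrightarrow> bounded_linear T"
  using vN by (auto simp: von_neumann_algebra_def cbops_def)

lemma mem_linear: "T \<in> M \<Longrightarrow> linear T"
  by (simp add: mem_bounded_linear bounded_linear.linear)

lemma commutant_bounded_linear: "S \<in> commutant J M \<Longrightarrow> bounded_linear S"
  by (simp add: commutant_def cbops_def)

lemma mem_commute: "T \<in> M \<Longrightarrow> S \<in> commutant J M \<Longrightarrow> T (S x) = S (T x)"
  by (auto simp: commutant_def fun_eq_iff)

text \<open>\<open>J\<close> lies in the commutant, so commuting with the commutant includes complex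
  linearity; the bicommutant property does the rest.\<close>

lemma memI:
  assumes "bounded_linear T" "\<And>S x. S \<in> commutant J M \<Longrightarrow> T (S x) = S (T x)"
  shows "T \<in> M"
proof -
  have "J \<in> commutant J M"
    using vN by (auto simp: commutant_def von_neumann_algebra_def cplx_structure_def cbops_def)
  then have "T \<in> commutant J (commutant J M)"
    using assms by (auto simp: commutant_def[of J "commutant J M"] cbops_def fun_eq_iff)
  then show ?thesis using vN by (simp add: von_neumann_algebra_def)
qed

lemma mem_id: "(\<lambda>x. x) \<in> M"
  by (rule memI) (simp_all add: bounded_linear_ident)

lemma mem_zero: "(\<lambda>x. 0) \<in> M"
  by (rule memI) (simp_all add: bounded_linear.linear linear_0 commutant_bounded_linear)

lemma mem_comp: "S \<in> M \<Longrightarrow> T \<in> M \<Longrightarrow> (\<lambda>x. S (T x)) \<in> M"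
  by (rule memI) (simp_all add: bounded_linear_compose mem_bounded_linear mem_commute)

lemma mem_add: "S \<in> M \<Longrightarrow> T \<in> M \<Longrightarrow> (\<lambda>x. S x + T x) \<in> M"
  by (rule memI) (simp_all add: bounded_linear_add mem_bounded_linear mem_commute
      linear_add[OF bounded_linear.linear[OF commutant_bounded_linear]])

lemma mem_diff: "S \<in> M \<Longrightarrow> T \<in> M \<Longrightarrow> (\<lambda>x. S x - T x) \<in> M"
  by (rule memI) (simp_all add: bounded_linear_sub mem_bounded_linear mem_commute
      linear_diff[OF bounded_linear.linear[OF commutant_bounded_linear]])

lemma mem_scaleR: "T \<in> M \<Longrightarrow> (\<lambda>x. c *\<^sub>R T x) \<in> M"
  by (rule memI) (simp_all add: bounded_linear_const_scaleR mem_bounded_linear mem_commute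
      linear_scale[OF bounded_linear.linear[OF commutant_bounded_linear]])

lemma mem_sum: "(\<And>i. i \<in> I \<Longrightarrow> T i \<in> M) \<Longrightarrow> (\<lambda>x. \<Sum>i\<in>I. T i x) \<in> M"
  by (induction I rule: infinite_finite_induct) (simp_all add: mem_zero mem_add)

lemma mem_funpow: "T \<in> M \<Longrightarrow> T ^^ n \<in> M"
proof (induction n)
  case (Suc n)
  then show ?case using mem_comp[of T "T ^^ n"] by (simp add: o_def)
qed (simp add: mem_id id_def)

lemmas mem_intros = mem_id mem_add mem_diff mem_scaleR mem_sum mem_funpow

text \<open>Closure under strong limits, stated for filters to cover sequences and directed nets
  alike. The bound by \<open>norm x\<close> passes to the limit and makes it bounded.\<close>

lemma mem_limit:
  assumes F: "F \<noteq> bot" and X: "\<And>x. eventually (\<lambda>i. X i \<in> M \<and> norm (X i x) \<le> norm x) F"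
    and V: "\<And>x. ((\<lambda>i. X i x) \<longlongrightarrow> V x) F"
  shows "V \<in> M"
proof (rule memI)
  have uniq: "V x = b" if "((\<lambda>i. X i x) \<longlongrightarrow> b) F" for x b
    using tendsto_unique[OF F V that] .
  have ev: "eventually (\<lambda>i. X i \<in> M) F" using X[of 0] by (rule eventually_mono) simp
  show "bounded_linear V"
  proof (rule bounded_linear_intro[where K = 1])
    fix x y show "V (x + y) = V x + V y"
    proof (rule uniq)
      have "eventually (\<lambda>i. X i x + X i y = X i (x + y)) F"
        using ev by (rule eventually_mono) (simp add: linear_add[OF mem_linear])
      then show "((\<lambda>i. X i (x + y)) \<longlongrightarrow> V x + V y) F"
        by (rule Lim_transform_eventually[rotated]) (intro tendsto_intros V)
    qed
  next
    fix c x show "V (c *\<^sub>R x) = c *\<^sub>R V x"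
    proof (rule uniq)
      have "eventually (\<lambda>i. c *\<^sub>R X i x = X i (c *\<^sub>R x)) F"
        using ev by (rule eventually_mono) (simp add: linear_scale[OF mem_linear])
      then show "((\<lambda>i. X i (c *\<^sub>R x)) \<longlongrightarrow> c *\<^sub>R V x) F"
        by (rule Lim_transform_eventually[rotated]) (intro tendsto_intros V)
    qed
  next
    fix x
    have "eventually (\<lambda>i. norm (X i x) \<le> norm x) F" using X[of x] by (rule eventually_mono) simp
    from tendsto_upperbound[OF tendsto_norm[OF V] this F] show "norm (V x) \<le> norm x * 1" by simp
  qed
  fix S x assume S: "S \<in> commutant J M"
  show "V (S x) = S (V x)"
  proof (rule uniq)
    have "eventually (\<lambda>i. S (X i x) = X i (S x)) F"
      using ev by (rule eventually_mono) (simp add: mem_commute S)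
    then show "((\<lambda>i. X i (S x)) \<longlongrightarrow> S (V x)) F"
      by (rule Lim_transform_eventually[rotated])
        (rule bounded_linear.tendsto[OF commutant_bounded_linear[OF S] V])
  qed
qed

lemma mem_seq_limit:
  assumes "\<And>n. X n \<in> M" "\<And>n x. norm (X n x) \<le> norm x" "\<And>x. (\<lambda>n. X n x) \<longlonglongrightarrow> V x"
  shows "V \<in> M"
  by (rule mem_limit[of sequentially X V]) (use assms in auto)

section \<open>Order and algebra of projections\<close>

abbreviation "\<P> \<equiv> projections M"

lemma projI:
  assumes "P \<in> M" "\<And>x. P (P x) = P x" "\<And>x y. inner (P x) y = inner x (P y)"
  shows "P \<in> \<P>"
  using assms by (auto simp: projections_def is_adjoint_def)

lemma proj_mem: "P \<in> \<P> \<Longrightarrow> P \<in> M" by (simp add: projections_def)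

lemma proj_idem: "P \<in> \<P> \<Longrightarrow> P (P x) = P x" by (auto simp: projections_def fun_eq_iff)

lemma proj_sym: "P \<in> \<P> \<Longrightarrow> inner (P x) y = inner x (P y)"
  by (simp add: projections_def is_adjoint_def)

lemma proj_linear: "P \<in> \<P> \<Longrightarrow> linear P" by (simp add: proj_mem mem_linear)

lemmas proj_simps = proj_idem linear_0[OF proj_linear] linear_add[OF proj_linear]
  linear_diff[OF proj_linear] linear_scale[OF proj_linear]

lemma proj_inner: "P \<in> \<P> \<Longrightarrow> inner (P x) x = (norm (P x))\<^sup>2"
  using proj_sym[of P "P x" x] by (simp add: power2_norm_eq_inner proj_idem)

lemma proj_pythagoras: "P \<in> \<P> \<Longrightarrow> (norm (P x))\<^sup>2 + (norm (x - P x))\<^sup>2 = (norm x)\<^sup>2"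
  using proj_inner[of P x] by (simp add: power2_norm_eq_inner inner_diff_left inner_diff_right inner_commute)

lemma proj_norm_le: "P \<in> \<P> \<Longrightarrow> norm (P x) \<le> norm x"
  using proj_pythagoras[of P x] zero_le_power2[of "norm (x - P x)"]
  by (intro power2_le_imp_le[OF _ norm_ge_zero]) linarith

lemma proj_zero: "(\<lambda>x. 0) \<in> \<P>" by (rule projI) (simp_all add: mem_zero)

lemma proj_compl: "P \<in> \<P> \<Longrightarrow> (\<lambda>x. x - P x) \<in> \<P>"
  by (rule projI)
    (simp_all add: mem_intros proj_mem proj_simps inner_diff_left inner_diff_right proj_sym)

text \<open>Taking adjoints turns \<open>P Q = P\<close> into \<open>Q P = P\<close>, that is,
  inclusion of ranges.\<close>

lemma proj_le_iff: "P \<in> \<P> \<Longrightarrow> Q \<in> \<P> \<Longrightarrow> proj_le P Q \<longleftrightarrow> (\<forall>x. Q (P x) = P x)"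
proof -
  assume P: "P \<in> \<P>" and Q: "Q \<in> \<P>"
  have "(\<forall>x. P (Q x) = P x) \<longleftrightarrow> (\<forall>x y. inner (P (Q x)) y = inner (P x) y)"
    by (metis vector_eq_rdot)
  also have "\<dots> \<longleftrightarrow> (\<forall>x y. inner x (Q (P y)) = inner x (P y))"
    by (simp add: proj_sym[OF P] proj_sym[OF Q])
  also have "\<dots> \<longleftrightarrow> (\<forall>x. Q (P x) = P x)" by (metis vector_eq_ldot)
  finally show ?thesis by (auto simp: proj_le_def fun_eq_iff)
qed

lemma proj_le_iff': "proj_le P Q \<longleftrightarrow> (\<forall>x. P (Q x) = P x)"
  by (auto simp: proj_le_def fun_eq_iff)

lemma proj_leI: "P \<in> \<P> \<Longrightarrow> Q \<in> \<P> \<Longrightarrow> (\<And>x. P x = x \<Longrightarrow> Q x = x) \<Longrightarrow> proj_le P Q"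
  by (simp add: proj_le_iff proj_idem)

lemma proj_leD: "P \<in> \<P> \<Longrightarrow> Q \<in> \<P> \<Longrightarrow> proj_le P Q \<Longrightarrow> P x = x \<Longrightarrow> Q x = x"
  by (metis proj_le_iff)

lemma proj_eqI:
  assumes "P \<in> \<P>" "Q \<in> \<P>" "\<And>x. P x = x \<longleftrightarrow> Q x = x"
  shows "P = Q"
proof
  fix x
  have "Q (P x) = P x" using assms(3)[of "P x"] proj_idem[OF assms(1)] by blast
  moreover have "proj_le Q P" using assms by (intro proj_leI) auto
  ultimately show "P x = Q x" by (simp add: proj_le_iff')
qed

lemma proj_diff:
  assumes "P \<in> \<P>" "Q \<in> \<P>" "proj_le P Q"
  shows "(\<lambda>x. Q x - P x) \<in> \<P>"
proof (rule projI)
  show "(\<lambda>x. Q x - P x) \<in> M" using assms by (intro mem_intros proj_mem)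
  have "Q (P x) = P x" "P (Q x) = P x" for x
    using assms proj_le_iff[of P Q] proj_le_iff'[of P Q] by blast+
  then show "Q (Q x - P x) - P (Q x - P x) = Q x - P x" for x
    using assms by (simp add: proj_simps)
  show "inner (Q x - P x) y = inner x (Q y - P y)" for x y
    using assms by (simp add: inner_diff_left inner_diff_right proj_sym)
qed

lemma norm_proj_diff:
  assumes "P \<in> \<P>" "Q \<in> \<P>" "proj_le P Q"
  shows "(norm (Q x - P x))\<^sup>2 = (norm (Q x))\<^sup>2 - (norm (P x))\<^sup>2"
  using proj_inner[OF proj_diff[OF assms], of x] proj_inner[OF assms(1), of x] proj_inner[OF assms(2), of x]
  by (simp add: inner_diff_left)

section \<open>Kernel projections, meets and joins\<close>

lemma positive_contraction_compl:
  assumes "A \<in> M" "\<And>x y. inner (A x) y = inner x (A y)" "\<And>x. 0 \<le> inner (A x) x"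
    "\<And>x. inner (A x) x \<le> inner x x"
  shows "positive_contraction (\<lambda>x. x - A x)"
proof (rule positive_contraction.intro)
  show "linear (\<lambda>x. x - A x)" by (intro mem_linear mem_intros assms)
  show "inner (x - A x) y = inner x (y - A y)" for x y
    by (simp add: inner_diff_left inner_diff_right assms(2))
qed (use assms(3,4) in \<open>simp_all add: inner_diff_left\<close>)

text \<open>The kernel projection of \<open>A\<close> is the strong limit of the powers of \<open>1 - A\<close>.\<close>

lemma ex_kernel_proj:
  assumes A: "A \<in> M" "\<And>x y. inner (A x) y = inner x (A y)" "\<And>x. 0 \<le> inner (A x) x"
    "\<And>x. inner (A x) x \<le> inner x x"
  obtains P where "P \<in> \<P>" "\<And>x. P x = x \<longleftrightarrow> A x = 0"
    "\<And>x. (\<lambda>n. inner (((\<lambda>x. x - A x) ^^ n) x) x) \<longlonglongrightarrow> (norm (P x))\<^sup>2"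
proof -
  interpret positive_contraction "\<lambda>x. x - A x"
    using A by (rule positive_contraction_compl)
  have mem: "fixproj \<in> M"
    by (rule mem_seq_limit[OF _ norm_funpow_le funpow_tendsto_fixproj]) (intro mem_intros A)
  have idem: "fixproj (fixproj x) = fixproj x" for x by (simp add: fixproj_fixed D_fixproj)
  have P: "fixproj \<in> \<P>" using mem idem fixproj_sym by (rule projI)
  have "fixproj x = x \<longleftrightarrow> A x = 0" for x
    using fixproj_fixed[of x] D_fixproj[of x] by auto
  moreover have "(\<lambda>n. inner (((\<lambda>x. x - A x) ^^ n) x) x) \<longlonglongrightarrow> (norm (fixproj x))\<^sup>2" for x
    using moment_tendsto[of x] proj_inner[OF P, of x] by (simp add: moment_def[abs_def])
  ultimately show thesis using P that by blast
qed

text \<open>The form of \<open>A\<close>, the mean of \<open>1 - P\<close> and \<open>1 - Q\<close>,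
  is half the sum of the squared distances to the two ranges; hence its kernel is their
  intersection. Averaging keeps \<open>A\<close> below 1.\<close>

lemma ex_proj_meet:
  assumes P: "P \<in> \<P>" and Q: "Q \<in> \<P>"
  obtains R where "R \<in> \<P>" "\<And>x. R x = x \<longleftrightarrow> P x = x \<and> Q x = x"
proof -
  define A where "A x = (1/2) *\<^sub>R ((x - P x) + (x - Q x))" for x
  note Pc = proj_compl[OF P] and Qc = proj_compl[OF Q]
  have form: "inner (A x) x = ((norm (x - P x))\<^sup>2 + (norm (x - Q x))\<^sup>2) / 2" for x
    using proj_inner[OF Pc, of x] proj_inner[OF Qc, of x] by (simp add: A_def inner_add_left)
  have "A \<in> M" unfolding A_def[abs_def] by (intro mem_intros proj_mem P Q)
  moreover have "inner (A x) y = inner x (A y)" for x y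
    by (simp add: A_def inner_add_left inner_add_right inner_diff_left inner_diff_right proj_sym P Q)
  moreover have "0 \<le> inner (A x) x" for x by (simp add: form)
  moreover have "inner (A x) x \<le> inner x x" for x
    using proj_norm_le[OF Pc, of x, THEN power_mono[of _ _ 2]] proj_norm_le[OF Qc, of x, THEN power_mono[of _ _ 2]]
    by (simp add: form power2_norm_eq_inner[of x])
  ultimately obtain R where R: "R \<in> \<P>" "\<And>x. R x = x \<longleftrightarrow> A x = 0"
    by (rule ex_kernel_proj) blast
  have "A x = 0 \<longleftrightarrow> P x = x \<and> Q x = x" for x
  proof
    assume "A x = 0"
    then have "(norm (x - P x))\<^sup>2 + (norm (x - Q x))\<^sup>2 = 0" using form[of x] by simp
    then show "P x = x \<and> Q x = x" by (simp add: add_nonneg_eq_0_iff)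
  qed (simp add: A_def)
  with R that show thesis by blast
qed

text \<open>The complement of the meet of the complements. A join is described by its kernel because
  its range is the closure of a sum, whereas its kernel is an intersection.\<close>

lemma ex_proj_join:
  assumes P: "P \<in> \<P>" and Q: "Q \<in> \<P>"
  obtains R where "R \<in> \<P>" "\<And>x. R x = 0 \<longleftrightarrow> P x = 0 \<and> Q x = 0"
proof -
  obtain S where S: "S \<in> \<P>" "\<And>x. S x = x \<longleftrightarrow> x - P x = x \<and> x - Q x = x"
    using ex_proj_meet[OF proj_compl[OF P] proj_compl[OF Q]] by blast
  have "x - S x = 0 \<longleftrightarrow> P x = 0 \<and> Q x = 0" for x
    using S(2)[of x] by (simp add: eq_commute[of x "S x"])
  then show thesis by (rule that[OF proj_compl[OF S(1)]])
qed

lemma proj_le_kernelI: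
  assumes "P \<in> \<P>" "Q \<in> \<P>" "\<And>x. Q x = 0 \<Longrightarrow> P x = 0"
  shows "proj_le P Q"
  unfolding proj_le_iff'
proof
  fix x
  have "P (x - Q x) = 0" by (rule assms(3)) (simp add: assms(2) proj_simps)
  then show "P (Q x) = P x" by (simp add: assms(1) proj_simps)
qed

text \<open>By \<open>norm_proj_diff\<close> the net \<open>a x\<close> satisfies the square
  increment bound with potential the squared norm, so it converges, and the strong limit is the
  least upper bound. The convergence clause is recorded because approximating sequences are
  extracted from it later.\<close>

lemma ex_directed_sup:
  assumes S: "S \<subseteq> \<P>" "S \<noteq> {}" "\<forall>a\<in>S. \<forall>b\<in>S. \<exists>c\<in>S. proj_le a c \<and> proj_le b c"
  shows "\<exists>s\<in>\<P>. (\<forall>a\<in>S. proj_le a s) \<and> (\<forall>u\<in>\<P>. (\<forall>a\<in>S. proj_le a u) \<longrightarrow> proj_le s u) \<and>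
    (\<forall>x. \<forall>e>0. \<exists>a\<in>S. \<forall>b\<in>S. proj_le a b \<longrightarrow> norm (b x - s x) < e)"
proof -
  have SP: "a \<in> \<P>" if "a \<in> S" for a using S that by blast
  have tr: "proj_le a c" if "proj_le a b" "proj_le b c" for a b c :: "'a \<Rightarrow> 'a"
    using that by (simp add: proj_le_iff') metis
  \<comment> \<open>The filter of tails of \<open>S\<close>, which makes the limit rules for filters
    available for the net.\<close>
  define F where "F = (INF a\<in>S. principal {b \<in> S. proj_le a b})"
  have ev: "eventually Q F \<longleftrightarrow> (\<exists>a\<in>S. \<forall>b\<in>S. proj_le a b \<longrightarrow> Q b)" for Q
    unfolding F_def
  proof (subst eventually_INF_base[OF S(2)])
    fix a b assume "a \<in> S" "b \<in> S"
    then obtain c where c: "c \<in> S" "proj_le a c" "proj_le b c" using S(3) by meson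
    then have "{d \<in> S. proj_le c d} \<subseteq> {d \<in> S. proj_le a d} \<inter> {d \<in> S. proj_le b d}"
      using tr by blast
    then show "\<exists>c\<in>S. principal {d \<in> S. proj_le c d} \<le> inf (principal {d \<in> S. proj_le a d}) (principal {d \<in> S. proj_le b d})"
      using c(1) by auto
  qed (auto simp: eventually_principal)
  have le_refl: "proj_le a a" if "a \<in> S" for a using SP[OF that] by (simp add: proj_le_iff' proj_idem)
  have F: "F \<noteq> bot"
    unfolding trivial_limit_def ev using le_refl by blast
  have "\<exists>l. \<forall>e>0. \<exists>a\<in>S. \<forall>b\<in>S. proj_le a b \<longrightarrow> norm (b x - l) < e" for x
  proof (rule convergent_of_square_increments[where \<phi> = "\<lambda>a. (norm (a x))\<^sup>2" and B = "(norm x)\<^sup>2"])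
    fix a assume "a \<in> S"
    then show "(norm (a x))\<^sup>2 \<le> (norm x)\<^sup>2" using proj_norm_le[OF SP] by (simp add: power_mono)
  qed (use S SP norm_proj_diff in auto)
  then obtain s where s: "\<And>x e. e > 0 \<Longrightarrow> \<exists>a\<in>S. \<forall>b\<in>S. proj_le a b \<longrightarrow> norm (b x - s x) < e" by metis
  have lim: "((\<lambda>a. a x) \<longlongrightarrow> s x) F" for x
    unfolding tendsto_iff ev dist_norm using s by blast
  have evS: "eventually (\<lambda>a. a \<in> S) F" unfolding ev using S(2) by blast
  have ge: "eventually (\<lambda>b. proj_le a b) F" if "a \<in> S" for a unfolding ev using that by blast
  \<comment> \<open>On the tail above \<open>a\<close> the net \<open>a (b x)\<close> is constantly
    \<open>a x\<close>.\<close>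
  have as: "a (s x) = a x" if "a \<in> S" for a x
  proof (rule tendsto_unique[OF F])
    show "((\<lambda>b. a (b x)) \<longlongrightarrow> a (s x)) F"
      by (rule bounded_linear.tendsto[OF mem_bounded_linear[OF proj_mem[OF SP[OF that]]] lim])
    show "((\<lambda>b. a (b x)) \<longlongrightarrow> a x) F"
      by (rule tendsto_eventually, rule eventually_mono[OF ge[OF that]]) (simp add: proj_le_iff')
  qed
  have "s \<in> M"
  proof (rule mem_limit[OF F _ lim])
    fix x show "eventually (\<lambda>a. a \<in> M \<and> norm (a x) \<le> norm x) F"
      using evS by (rule eventually_mono) (use SP proj_norm_le proj_mem in blast)
  qed
  moreover have "s (s x) = s x" for x
  proof (rule tendsto_unique[OF F lim])
    show "((\<lambda>a. a (s x)) \<longlongrightarrow> s x) F"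
      by (rule Lim_transform_eventually[OF lim]) (rule eventually_mono[OF evS], simp add: as)
  qed
  moreover have "inner (s x) y = inner x (s y)" for x y
  proof (rule tendsto_unique[OF F])
    show "((\<lambda>a. inner (a x) y) \<longlongrightarrow> inner (s x) y) F" by (intro tendsto_intros lim)
    have "((\<lambda>a. inner x (a y)) \<longlongrightarrow> inner x (s y)) F" by (intro tendsto_intros lim)
    then show "((\<lambda>a. inner (a x) y) \<longlongrightarrow> inner x (s y)) F"
      by (rule Lim_transform_eventually) (rule eventually_mono[OF evS], simp add: proj_sym SP)
  qed
  ultimately have sP: "s \<in> \<P>" by (rule projI)
  show ?thesis
  proof (intro bexI[OF _ sP] conjI ballI impI allI s)
    show "proj_le a s" if "a \<in> S" for a using as[OF that] by (simp add: proj_le_iff')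
    fix u assume u: "u \<in> \<P>" "\<forall>a\<in>S. proj_le a u"
    have "u (s x) = s x" for x
    proof (rule tendsto_unique[OF F _ lim])
      have "((\<lambda>a. u (a x)) \<longlongrightarrow> u (s x)) F"
        by (rule bounded_linear.tendsto[OF mem_bounded_linear[OF proj_mem[OF u(1)]] lim])
      then show "((\<lambda>a. a x) \<longlongrightarrow> u (s x)) F"
      proof (rule Lim_transform_eventually)
        show "eventually (\<lambda>a. u (a x) = a x) F"
          using evS by (rule eventually_mono) (use u SP proj_le_iff in blast)
      qed
    qed
    then show "proj_le s u" using proj_le_iff[OF sP u(1)] by blast
  qed
qed

sublocale lattice: directed_meet_poset \<P> proj_le "\<lambda>x. 0"
proof
  fix a b c :: "'a \<Rightarrow> 'a"
  assume a: "a \<in> \<P>"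
  show "proj_le a a" using a by (simp add: proj_le_iff' proj_idem)
  show "proj_le (\<lambda>x. 0) a" by (simp add: proj_le_iff')
  assume b: "b \<in> \<P>"
  show "a = b" if "proj_le a b" "proj_le b a"
    using that proj_le_iff[OF a b] by (simp add: proj_le_iff' fun_eq_iff)
  show "proj_le a c" if "proj_le a b" "proj_le b c"
    using that by (simp add: proj_le_iff') metis
  obtain R where R: "R \<in> \<P>" "\<And>x. R x = x \<longleftrightarrow> a x = x \<and> b x = x" using ex_proj_meet[OF a b] by blast
  have "proj_le d R" if "d \<in> \<P>" "proj_le d a" "proj_le d b" for d
    using that R a b by (intro proj_leI) (auto dest: proj_leD)
  moreover have "proj_le R a" "proj_le R b" using R a b by (auto intro: proj_leI)
  ultimately show "\<exists>c\<in>\<P>. proj_le c a \<and> proj_le c b \<and> (\<forall>d\<in>\<P>. proj_le d a \<and> proj_le d b \<longrightarrow> proj_le d c)"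
    using R(1) by blast
next
  fix S assume "S \<subseteq> \<P>" "S \<noteq> {}" "\<forall>a\<in>S. \<forall>b\<in>S. \<exists>c\<in>S. proj_le a c \<and> proj_le b c"
  from ex_directed_sup[OF this]
  show "\<exists>s\<in>\<P>. (\<forall>x\<in>S. proj_le x s) \<and> (\<forall>u\<in>\<P>. (\<forall>x\<in>S. proj_le x u) \<longrightarrow> proj_le s u)"
    by (elim bexE conjE, intro bexI conjI)
qed (rule proj_zero)

lemma meet_eq_zero_iff:
  assumes a: "a \<in> \<P>" and b: "b \<in> \<P>"
  shows "lat_meet \<P> proj_le a b = (\<lambda>x. 0) \<longleftrightarrow> (\<forall>x. a x = x \<and> b x = x \<longrightarrow> x = 0)"
proof -
  note m = lattice.meet_props[OF a b]
  obtain R where R: "R \<in> \<P>" "\<And>x. R x = x \<longleftrightarrow> a x = x \<and> b x = x" using ex_proj_meet[OF a b] by blast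
  have "proj_le R a" "proj_le R b" using R a b by (auto intro: proj_leI)
  then have "proj_le R (lat_meet \<P> proj_le a b)" using m(4) R(1) by blast
  then have iff: "lat_meet \<P> proj_le a b x = x \<longleftrightarrow> a x = x \<and> b x = x" for x
    using R m a b by (meson proj_leD)
  show ?thesis
  proof
    assume "lat_meet \<P> proj_le a b = (\<lambda>x. 0)"
    then show "\<forall>x. a x = x \<and> b x = x \<longrightarrow> x = 0" using iff by metis
  next
    assume "\<forall>x. a x = x \<and> b x = x \<longrightarrow> x = 0"
    then have "lat_meet \<P> proj_le a b x = 0" for x
      using iff[of "lat_meet \<P> proj_le a b x"] proj_idem[OF m(1), of x] by metis
    then show "lat_meet \<P> proj_le a b = (\<lambda>x. 0)" by auto
  qed
qed

section \<open>Embeddings and modularity in finite algebras\<close>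

text \<open>The isometry is the polar part of \<open>q p\<close>: with \<open>D = 1 - p q p\<close> it is the strong limit
  of \<open>q p (\<Sum>i\<le>n. isq i D\<^sup>i)\<close>, formally \<open>q p (p q p) powr (- 1/2)\<close>.\<close>

lemma ex_embedding:
  assumes p: "p \<in> \<P>" and q: "q \<in> \<P>" and inj: "\<And>x. p x = x \<Longrightarrow> q x = 0 \<Longrightarrow> x = 0"
  obtains V where "V \<in> M" "\<And>x. norm (V x) = norm (p x)" "\<And>x. q (V x) = V x"
proof -
  define A where "A x = p (q (p x))" for x
  have Ainner: "inner (A x) y = inner (q (p x)) (q (p y))" for x y
    using proj_sym[OF q, of "q (p x)" "p y"] by (simp add: A_def proj_sym[OF p] proj_idem[OF q])
  have A: "A \<in> M"
    unfolding A_def[abs_def] using mem_comp[OF proj_mem[OF p] mem_comp[OF proj_mem[OF q] proj_mem[OF p]]] .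
  have Asym: "inner (A x) y = inner x (A y)" for x y
    using Ainner[of x y] Ainner[of y x] by (simp add: inner_commute)
  have Apos: "0 \<le> inner (A x) x" for x by (simp add: Ainner)
  have Ale: "inner (A x) x \<le> inner x x" for x
    using order_trans[OF proj_norm_le[OF q, of "p x"] proj_norm_le[OF p, of x]]
    by (simp add: Ainner norm_le)
  obtain N where N: "N \<in> \<P>" "\<And>x. N x = x \<longleftrightarrow> A x = 0"
    "\<And>x. (\<lambda>n. inner (((\<lambda>x. x - A x) ^^ n) x) x) \<longlonglongrightarrow> (norm (N x))\<^sup>2"
    using ex_kernel_proj[OF A Asym Apos Ale] by blast
  \<comment> \<open>Injectivity of \<open>q\<close> on the range of \<open>p\<close> enters here: it
    makes the kernel of \<open>p q p\<close> no larger than that of \<open>p\<close>.\<close>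
  have "A x = 0 \<longleftrightarrow> x - p x = x" for x
  proof
    assume "A x = 0"
    then have "q (p x) = 0" using Ainner[of x x] by simp
    then show "x - p x = x" using inj[of "p x"] proj_idem[OF p] by simp
  qed (simp add: A_def proj_simps p q)
  then have Np: "N = (\<lambda>x. x - p x)" using N by (intro proj_eqI proj_compl p) auto
  interpret positive_contraction "\<lambda>x. x - A x"
    using A Asym Apos Ale by (rule positive_contraction_compl)
  define X where "X n x = q (p (isq_poly n x))" for n x
  have "isq_poly n \<in> M" for n
    unfolding isq_poly_def[abs_def] by (intro mem_intros A)
  then have XM: "X n \<in> M" for n
    unfolding X_def[abs_def] using mem_comp[OF proj_mem[OF q] mem_comp[OF proj_mem[OF p]]] by blast
  \<comment> \<open>With \<open>D = 1 - A\<close> the operator \<open>1 - D\<close> is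
    \<open>A\<close>, so inner products of the \<open>X n x\<close> are the Gram sums estimated
    above.\<close>
  have Xinner: "inner (X m x) (X n x) = inner (isq_poly m x - (isq_poly m x - A (isq_poly m x))) (isq_poly n x)" for m n x
    by (simp add: X_def Ainner)
  have Xlow: "inner x x - moment x (Suc n) \<le> (norm (X n x))\<^sup>2"
    and Xup: "(norm (X n x))\<^sup>2 \<le> inner x x - moment x (Suc (2 * n))" for n x
    unfolding power2_norm_eq_inner Xinner by (fact gram_bounds)+
  have Xle: "(norm (X n x))\<^sup>2 \<le> (norm x)\<^sup>2" for n x
    using Xup[of n x] moment_nonneg[of x "Suc (2 * n)"] by (simp add: power2_norm_eq_inner[of x])
  have "convergent (\<lambda>n. X n x)" for x
  proof (rule convergent_of_square_increments_seq[OF _ Xle])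
    fix m n :: nat assume "m \<le> n"
    then have "inner (X m x) (X m x) \<le> inner (X n x) (X m x)"
      unfolding Xinner by (rule gram_mono)
    then show "(norm (X n x - X m x))\<^sup>2 \<le> (norm (X n x))\<^sup>2 - (norm (X m x))\<^sup>2"
      by (simp add: power2_norm_eq_inner inner_diff_left inner_diff_right inner_commute)
  qed
  then obtain V where V: "\<And>x. (\<lambda>n. X n x) \<longlonglongrightarrow> V x" unfolding convergent_def by metis
  have "V \<in> M"
    by (rule mem_seq_limit[OF XM _ V]) (rule power2_le_imp_le[OF Xle norm_ge_zero])
  moreover have "norm (V x) = norm (p x)" for x
  proof -
    have mom: "moment x \<longlonglongrightarrow> (norm (x - p x))\<^sup>2"
      using N(3)[of x] unfolding Np moment_def[abs_def] .
    \<comment> \<open>Both bounds tend to the same value, since the moments tend to the squared norm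
      of the kernel component \<open>x - p x\<close>.\<close>
    have "(\<lambda>n. (norm (X n x))\<^sup>2) \<longlonglongrightarrow> inner x x - (norm (x - p x))\<^sup>2"
    proof (rule tendsto_sandwich)
      show "(\<lambda>n. inner x x - moment x (Suc n)) \<longlonglongrightarrow> inner x x - (norm (x - p x))\<^sup>2"
        by (intro tendsto_intros LIMSEQ_Suc mom)
      have "strict_mono (\<lambda>n::nat. Suc (2 * n))" by (simp add: strict_mono_def)
      from LIMSEQ_subseq_LIMSEQ[OF mom this]
      show "(\<lambda>n. inner x x - moment x (Suc (2 * n))) \<longlonglongrightarrow> inner x x - (norm (x - p x))\<^sup>2"
        by (intro tendsto_intros) (simp add: o_def)
    qed (simp_all add: Xlow Xup)
    moreover have "(\<lambda>n. (norm (X n x))\<^sup>2) \<longlonglongrightarrow> (norm (V x))\<^sup>2" by (intro tendsto_intros V)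
    ultimately have "(norm (V x))\<^sup>2 = inner x x - (norm (x - p x))\<^sup>2" by (rule LIMSEQ_unique[rotated])
    also have "\<dots> = (norm (p x))\<^sup>2" using proj_pythagoras[OF p, of x] by (simp add: power2_norm_eq_inner[of x])
    finally show ?thesis by simp
  qed
  moreover have "q (V x) = V x" for x
  proof (rule LIMSEQ_unique[OF _ V])
    have "(\<lambda>n. q (X n x)) \<longlonglongrightarrow> q (V x)"
      by (rule bounded_linear.tendsto[OF mem_bounded_linear[OF proj_mem[OF q]] V])
    then show "(\<lambda>n. X n x) \<longlonglongrightarrow> q (V x)" by (simp add: X_def proj_idem q)
  qed
  ultimately show thesis by (rule that)
qed

section \<open>Isometries in a finite algebra\<close>

lemma ex_adjoint:
  assumes "V \<in> M"
  obtains W where "W \<in> M" "\<And>x y. inner (V x) y = inner x (W y)"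
  using assms vN unfolding von_neumann_algebra_def is_adjoint_def by blast

text \<open>With \<open>W\<close> the adjoint of \<open>V\<close>, the range projection
  \<open>V W\<close> is equivalent to the identity, so finiteness makes it the identity and
  \<open>V\<close> onto.\<close>

lemma finite_isometry_dense:
  assumes fin: "finite_vNa M" and V: "V \<in> M" "\<And>x. norm (V x) = norm x"
    and e: "e \<in> \<P>" "\<And>x. e (V x) = 0"
  shows "e x = 0"
proof -
  obtain W where W: "W \<in> M" "\<And>x y. inner (V x) y = inner x (W y)" using ex_adjoint[OF V(1)] by blast
  have "inner (V x) (V y) = inner x y" for x y
    using V(2)[of "x + y"] by (simp add: dot_norm V(2) linear_add[OF mem_linear[OF V(1)]])
  then have WV: "W (V x) = x" for x
    by (metis W(2) vector_eq_ldot)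
  have adj: "inner (W x) y = inner x (V y)" for x y by (metis W(2) inner_commute)
  define E where "E x = V (W x)" for x
  have "E \<in> \<P>"
  proof (rule projI)
    show "E \<in> M" unfolding E_def[abs_def] by (rule mem_comp[OF V(1) W(1)])
  qed (simp_all add: E_def WV W(2) adj)
  moreover have "mvn_equiv M E id"
    unfolding mvn_equiv_def is_adjoint_def using V(1) W(1) adj WV
    by (intro bexI[of _ W] bexI[of _ V]) (auto simp: E_def fun_eq_iff)
  ultimately have "E = id" using fin by (auto simp: finite_vNa_def proj_le_def)
  then have "e x = e (V (W x))" by (simp add: E_def fun_eq_iff)
  then show ?thesis by (simp add: e(2))
qed

text \<open>Adding the identity on the complement of \<open>c\<close> extends \<open>T\<close> to an
  isometry of the whole space, and \<open>e\<close> kills the added part because \<open>e\<close>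
  lies below \<open>c\<close>.\<close>

lemma finite_corner_isometry_dense:
  assumes fin: "finite_vNa M" and c: "c \<in> \<P>"
    and T: "T \<in> M" "\<And>x. norm (T x) = norm (c x)" "\<And>x. c (T x) = T x"
    and e: "e \<in> \<P>" "proj_le e c" "\<And>x. e (T x) = 0"
  shows "e x = 0"
proof (rule finite_isometry_dense[OF fin _ _ e(1)])
  show "(\<lambda>x. T x + (x - c x)) \<in> M" by (intro mem_intros T proj_mem c)
  show "norm (T x + (x - c x)) = norm x" for x
  proof -
    have "inner (T x) (x - c x) = inner (c (T x)) (x - c x)" by (simp add: T(3))
    also have "\<dots> = 0" by (simp add: proj_sym[OF c] proj_simps c)
    finally have "(norm (T x + (x - c x)))\<^sup>2 = (norm (T x))\<^sup>2 + (norm (x - c x))\<^sup>2"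
      by (simp add: power2_norm_eq_inner inner_add_left inner_add_right inner_commute)
    also have "\<dots> = (norm x)\<^sup>2" using proj_pythagoras[OF c] by (simp add: T(2))
    finally show ?thesis by simp
  qed
  show "e (T x + (x - c x)) = 0" for x
    using e by (simp add: proj_simps proj_le_iff')
qed

text \<open>Modularity: with \<open>c' = (a \<or> b) \<and> c\<close> there are embeddings
  of \<open>c'\<close> into \<open>(a \<or> b) - b\<close> and of \<open>(a \<or> b) - b\<close> into \<open>a \<le> c'\<close>.\<close>

lemma finite_modular:
  assumes fin: "finite_vNa M" and a: "a \<in> \<P>" and b: "b \<in> \<P>" and c: "c \<in> \<P>" and s: "s \<in> \<P>"
    and ac: "proj_le a c" and bc: "\<And>x. b x = x \<Longrightarrow> c x = x \<Longrightarrow> x = 0"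
    and join: "\<And>x. s x = 0 \<longleftrightarrow> a x = 0 \<and> b x = 0"
    and x: "c x = x" "s x = x" "a x = 0"
  shows "x = 0"
proof -
  have as: "proj_le a s" and bs: "proj_le b s" using proj_le_kernelI a b s join by auto
  obtain c' where c': "c' \<in> \<P>" "\<And>x. c' x = x \<longleftrightarrow> s x = x \<and> c x = x" using ex_proj_meet[OF s c] by blast
  have ac': "proj_le a c'" using a c' proj_leD[OF a c ac] proj_leD[OF a s as] by (intro proj_leI) auto
  define r where "r x = s x - b x" for x
  have r: "r \<in> \<P>" unfolding r_def[abs_def] by (rule proj_diff[OF b s bs])
  \<comment> \<open>Such a \<open>y\<close> is fixed by \<open>s\<close>, hence by \<open>b\<close>,
    and lies in \<open>c\<close>, which meets \<open>b\<close> trivially.\<close>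
  have "y = 0" if "c' y = y" "r y = 0" for y
    using that c'(2) bc[of y] by (auto simp: r_def)
  then obtain V where V: "V \<in> M" "\<And>x. norm (V x) = norm (c' x)" "\<And>x. r (V x) = V x"
    using ex_embedding[OF c'(1) r] by blast
  have "y = 0" if y: "r y = y" "a y = 0" for y
  proof -
    have "b y = b (s y) - b (b y)" using y(1) b by (metis r_def proj_simps(4))
    then have "b y = 0" using bs b by (simp add: proj_le_iff' proj_idem)
    then have "s y = 0" using join y by blast
    then show ?thesis using y(1) \<open>b y = 0\<close> by (simp add: r_def)
  qed
  then obtain U where U: "U \<in> M" "\<And>x. norm (U x) = norm (r x)" "\<And>x. a (U x) = U x"
    using ex_embedding[OF r a] by blast
  \<comment> \<open>\<open>U V\<close> maps the range of \<open>c'\<close> isometrically into that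
    of \<open>a\<close>, so \<open>e\<close> vanishes on its image and finiteness gives
    \<open>c' = a\<close>.\<close>
  define e where "e x = c' x - a x" for x
  have e: "e \<in> \<P>" unfolding e_def[abs_def] by (rule proj_diff[OF a c'(1) ac'])
  have aU: "c' (U y) = U y" for y using proj_leD[OF a c'(1) ac' U(3)] .
  have "e x = 0"
  proof (rule finite_corner_isometry_dense[OF fin c'(1), where T = "\<lambda>x. U (V x)" and e = e])
    show "(\<lambda>x. U (V x)) \<in> M" by (rule mem_comp[OF U(1) V(1)])
    show "proj_le e c'" using e c' ac' a unfolding proj_le_iff'
      by (simp add: e_def proj_idem proj_le_iff')
  qed (simp_all add: U V e aU e_def)
  moreover have "c' x = x" using c'(2) x by blast
  ultimately show "x = 0" using x(3) by (simp add: e_def)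
qed

text \<open>Write \<open>s n\<close> for the join of \<open>d n\<close> and \<open>b\<close>. The
  embeddings \<open>V n\<close> of the increments of \<open>d\<close> into those of \<open>s\<close>
  have mutually orthogonal ranges, all orthogonal to \<open>b\<close>; their strong sum
  \<open>W\<close> is isometric on the range of \<open>a\<close> and maps into it.\<close>

lemma finite_sequence_meet:
  assumes fin: "finite_vNa M" and d: "\<And>n. d n \<in> \<P>" "\<And>x. d 0 x = 0" "\<And>n. proj_le (d n) (d (Suc n))"
    and a: "a \<in> \<P>" "\<And>n. proj_le (d n) a" "\<And>x. (\<lambda>n. d n x) \<longlonglongrightarrow> a x"
    and b: "b \<in> \<P>" "proj_le b a" "\<And>n x. b x = x \<Longrightarrow> d n x = x \<Longrightarrow> x = 0"
  shows "b x = 0"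
proof -
  obtain s where s: "\<And>n. s n \<in> \<P>" "\<And>n x. s n x = 0 \<longleftrightarrow> d n x = 0 \<and> b x = 0"
  proof -
    have "\<exists>R. R \<in> \<P> \<and> (\<forall>x. R x = 0 \<longleftrightarrow> d n x = 0 \<and> b x = 0)" for n
      by (rule ex_proj_join[OF d(1)[of n] b(1)]) blast
    then have "\<exists>s. \<forall>n. s n \<in> \<P> \<and> (\<forall>x. s n x = 0 \<longleftrightarrow> d n x = 0 \<and> b x = 0)" by (intro choice allI)
    with that show thesis by blast
  qed
  have ds: "proj_le (d n) (s n)" for n by (rule proj_le_kernelI[OF d(1) s(1)]) (simp add: s(2))
  have bs: "proj_le b (s n)" for n by (rule proj_le_kernelI[OF b(1) s(1)]) (simp add: s(2))
  have ker: "P x = 0" if "proj_le P Q" "P \<in> \<P>" "Q x = 0" for P Q x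
    using that by (metis proj_le_iff' proj_simps(2))
  have ss: "proj_le (s n) (s (Suc n))" for n
    by (rule proj_le_kernelI[OF s(1) s(1)]) (use ker[OF d(3) d(1)] in \<open>simp add: s(2)\<close>)
  have sa: "proj_le (s n) a" for n
    by (rule proj_le_kernelI[OF s(1) a(1)]) (use ker[OF a(2) d(1)] ker[OF b(2,1)] in \<open>simp add: s(2)\<close>)
  have smono: "proj_le (s m) (s n)" if "m \<le> n" for m n
    using that
  proof (induction n rule: dec_induct)
    case (step n)
    then show ?case using lattice.trans[OF s(1) s(1) s(1) step.IH ss] by blast
  qed (use lattice.refl s in blast)
  have "\<exists>V\<in>M. (\<forall>x. norm (V x) = norm (d (Suc n) x - d n x)) \<and> (\<forall>x. s (Suc n) (V x) - s n (V x) = V x)" for n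
  proof -
    \<comment> \<open>A vector of the increment of \<open>d\<close> killed by that of
      \<open>s\<close> lies in \<open>d (Suc n)\<close> and in \<open>s n\<close> and is orthogonal
      to \<open>d n\<close>; modularity makes it zero.\<close>
    have "y = 0" if y: "d (Suc n) y - d n y = y" "s (Suc n) y - s n y = 0" for y
    proof (rule finite_modular[OF fin d(1) b(1) d(1) s(1) d(3)[of n] b(3) s(2)])
      have "d n y = d n (d (Suc n) y) - d n (d n y)" using y(1) d(1) by (metis proj_simps(4))
      then show 0: "d n y = 0" using d(3)[of n] d(1) by (simp add: proj_le_iff' proj_idem)
      then show 1: "d (Suc n) y = y" using y(1) by simp
      have "s (Suc n) y = y" by (rule proj_leD[OF d(1) s(1) ds 1])
      then show "s n y = y" using y(2) by simp
    qed
    then show ?thesis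
      by (rule ex_embedding[OF proj_diff[OF d(1) d(1) d(3)[of n]] proj_diff[OF s(1) s(1) ss[of n]]]) blast+
  qed
  then obtain V where V: "\<And>n. V n \<in> M" "\<And>n x. norm (V n x) = norm (d (Suc n) x - d n x)"
      "\<And>n x. s (Suc n) (V n x) - s n (V n x) = V n x" by metis
  have sVl: "s m (V i x) = V i x" if "i < m" for m i x
  proof -
    have "s (Suc i) (V i x) = V i x"
      using V(3)[of i x] ss[of i] s(1) by (metis proj_simps(1,4) proj_le_iff)
    then show ?thesis using proj_leD[OF s(1) s(1) smono] that by (metis Suc_leI)
  qed
  have sVg: "s m (V i x) = 0" if "m \<le> i" for m i x
  proof -
    have "s m (V i x) = s m (s (Suc i) (V i x)) - s m (s i (V i x))"
      using V(3)[of i x] s(1) by (metis proj_simps(4))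
    then show ?thesis using smono[of m i] smono[of m "Suc i"] that by (simp add: proj_le_iff')
  qed
  define T where "T n x = (\<Sum>i<n. V i x)" for n x
  have TM: "T n \<in> M" for n unfolding T_def[abs_def] by (intro mem_intros V)
  \<comment> \<open>The range of \<open>V i\<close> lies in \<open>s (Suc i)\<close> and is
    orthogonal to \<open>s i\<close>, so \<open>s m\<close> cuts the sum off at
    \<open>m\<close>.\<close>
  have sT: "s m (T n x) = T m x" if "m \<le> n" for m n x
  proof -
    have "s m (T n x) = (\<Sum>i<n. s m (V i x))" unfolding T_def by (rule linear_sum[OF proj_linear[OF s(1)]])
    also have "\<dots> = (\<Sum>i<m. s m (V i x))"
      using that by (intro sum.mono_neutral_right) (auto simp: sVg)
    finally show ?thesis by (simp add: T_def sVl)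
  qed
  \<comment> \<open>The new summand is orthogonal to the earlier ones and the squared norms
    telescope, starting from \<open>d 0 = 0\<close>.\<close>
  have Tnorm: "(norm (T n x))\<^sup>2 = (norm (d n x))\<^sup>2" for n x
  proof (induction n)
    case (Suc n)
    have "T (Suc n) x = T n x + V n x" by (simp add: T_def)
    moreover have "inner (T n x) (V n x) = inner (T n x) (s n (V n x))"
      using proj_sym[OF s(1), of n "T n x" "V n x"] sT[of n n x] by simp
    then have "inner (T n x) (V n x) = 0" by (simp add: sVg)
    ultimately have "(norm (T (Suc n) x))\<^sup>2 = (norm (T n x))\<^sup>2 + (norm (V n x))\<^sup>2"
      by (simp add: power2_norm_eq_inner inner_add_left inner_add_right inner_commute)
    then show ?case using Suc norm_proj_diff[OF d(1) d(1) d(3)[of n], of x] by (simp add: V(2))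
  qed (simp add: T_def d(2))
  have Tle: "(norm (T n x))\<^sup>2 \<le> (norm x)\<^sup>2" for n x
    using proj_norm_le[OF d(1)] by (simp add: Tnorm power_mono)
  have "convergent (\<lambda>n. T n x)" for x
  proof (rule convergent_of_square_increments_seq[OF _ Tle])
    fix m n :: nat assume "m \<le> n"
    then show "(norm (T n x - T m x))\<^sup>2 \<le> (norm (T n x))\<^sup>2 - (norm (T m x))\<^sup>2"
      using proj_pythagoras[OF s(1), of m "T n x"] by (simp add: sT)
  qed
  then obtain W where W: "\<And>x. (\<lambda>n. T n x) \<longlonglongrightarrow> W x" unfolding convergent_def by metis
  have fixW: "P (W x) = l" if P: "P \<in> \<P>" and "(\<lambda>n. P (T n x)) \<longlonglongrightarrow> l" for P x l
    using LIMSEQ_unique[OF bounded_linear.tendsto[OF mem_bounded_linear[OF proj_mem[OF P]] W] that(2)] .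
  show ?thesis
  proof (rule finite_corner_isometry_dense[OF fin a(1) _ _ _ b(1,2), where T = W])
    show "W \<in> M" by (rule mem_seq_limit[OF TM _ W]) (rule power2_le_imp_le[OF Tle norm_ge_zero])
    fix x
    have "norm (T n x) = norm (d n x)" for n using Tnorm[of n x] by simp
    then have "(\<lambda>n. norm (T n x)) \<longlonglongrightarrow> norm (a x)" using tendsto_norm[OF a(3)] by simp
    then show "norm (W x) = norm (a x)" using LIMSEQ_unique[OF tendsto_norm[OF W]] by blast
    have "a (T n x) = T n x" for n
      using proj_leD[OF s(1) a(1) sa sT[of n n x]] by simp
    then show "a (W x) = W x" using W by (intro fixW a) simp
    have "b (T n x) = 0" for n
    proof -
      have "b (V i x) = 0" for i
        using bs[of i] sVg[of i i x] b(1) by (metis le_refl proj_le_iff' proj_simps(2))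
      then show ?thesis by (simp add: T_def linear_sum[OF proj_linear[OF b(1)]])
    qed
    then show "b (W x) = 0" by (intro fixW b) simp
  qed
qed

section \<open>Finiteness and finite type\<close>

text \<open>A sequence in \<open>S\<close> need not have join \<open>s\<close>. It suffices to
  follow one nonzero vector \<open>x\<close> of \<open>b\<close>, and for this a sequence converging
  at \<open>x\<close> is enough.\<close>

lemma finite_type_if_finite:
  assumes fin: "finite_vNa M"
  shows "finite_type \<P> proj_le"
proof (rule lattice.finite_typeI, rule ccontr)
  fix S s b
  assume S: "S \<subseteq> \<P>" "S \<noteq> {}" and dir: "\<forall>a\<in>S. \<forall>b\<in>S. \<exists>c\<in>S. proj_le a c \<and> proj_le b c"
    and s: "s \<in> \<P>" "\<forall>x\<in>S. proj_le x s" "\<forall>u\<in>\<P>. (\<forall>x\<in>S. proj_le x u) \<longrightarrow> proj_le s u"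
    and b: "b \<in> \<P>" "proj_le b s" "b \<noteq> (\<lambda>x. 0)"
    and "\<not> (\<exists>a\<in>S. lat_meet \<P> proj_le b a \<noteq> (\<lambda>x. 0))"
  then have triv: "x = 0" if "a \<in> S" "b x = x" "a x = x" for a x
    using that meet_eq_zero_iff[of b a] by blast
  obtain x where x: "b x = x" "x \<noteq> 0" using b(1,3) proj_idem by blast
  have sx: "s x = x" by (rule proj_leD[OF b(1) s(1) b(2) x(1)])
  have near: "\<exists>a\<in>S. \<forall>c\<in>S. proj_le a c \<longrightarrow> norm (c x - x) < e" if "e > 0" for e
  proof -
    obtain s' where s': "s' \<in> \<P>" "\<forall>a\<in>S. proj_le a s'"
      "\<forall>x. \<forall>e>0. \<exists>a\<in>S. \<forall>b\<in>S. proj_le a b \<longrightarrow> norm (b x - s' x) < e"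
      using ex_directed_sup[OF S dir] by (elim bexE conjE)
    have "proj_le s s'" using s s' by blast
    then have "s' x = x" using proj_leD[OF s(1) s'(1)] sx by blast
    then show ?thesis using s'(3)[rule_format, OF that, of x] by simp
  qed
  \<comment> \<open>Each new member is taken above the old one and above a member beyond which the
    error at \<open>x\<close> stays small.\<close>
  have "\<exists>a. \<forall>n. (a n \<in> S \<and> norm (a n x - x) < 1 / Suc n) \<and> proj_le (a n) (a (Suc n))"
  proof (rule dependent_nat_choice)
    obtain a where "a \<in> S" "\<forall>c\<in>S. proj_le a c \<longrightarrow> norm (c x - x) < 1 / Suc 0"
      using near[of "1 / Suc 0"] by auto
    then show "\<exists>a. a \<in> S \<and> norm (a x - x) < 1 / Suc 0"
      using S(1) lattice.refl by blast
  next
    fix a n assume a: "a \<in> S \<and> norm (a x - x) < 1 / Suc n"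
    obtain c where c: "c \<in> S" "\<forall>d\<in>S. proj_le c d \<longrightarrow> norm (d x - x) < 1 / Suc (Suc n)"
      using near[of "1 / Suc (Suc n)"] by auto
    then obtain d where "d \<in> S" "proj_le a d" "proj_le c d" using dir a by meson
    then show "\<exists>d. (d \<in> S \<and> norm (d x - x) < 1 / Suc (Suc n)) \<and> proj_le a d" using c by blast
  qed
  then obtain a where a: "\<And>n. a n \<in> S" "\<And>n. norm (a n x - x) < 1 / Suc n" "\<And>n. proj_le (a n) (a (Suc n))"
    by blast
  have aP: "a n \<in> \<P>" for n using a(1) S(1) by blast
  have amono: "proj_le (a m) (a n)" if "m \<le> n" for m n
    using that
  proof (induction n rule: dec_induct)
    case (step n)
    then show ?case using lattice.trans[OF aP aP aP step.IH a(3)] by blast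
  qed (use lattice.refl aP in blast)
  have dira: "\<forall>p\<in>range a. \<forall>q\<in>range a. \<exists>r\<in>range a. proj_le p r \<and> proj_le q r"
  proof clarify
    fix m n
    show "\<exists>r\<in>range a. proj_le (a m) r \<and> proj_le (a n) r"
      using amono[of m "max m n"] amono[of n "max m n"] by auto
  qed
  have rangea: "range a \<subseteq> \<P>" "range a \<noteq> {}" using aP by auto
  obtain \<alpha> where \<alpha>: "\<alpha> \<in> \<P>" "\<forall>p\<in>range a. proj_le p \<alpha>"
    "\<forall>x. \<forall>e>0. \<exists>p\<in>range a. \<forall>q\<in>range a. proj_le p q \<longrightarrow> norm (q x - \<alpha> x) < e"
    using ex_directed_sup[OF rangea dira] by (elim bexE conjE)
  have lim: "(\<lambda>n. a n y) \<longlonglongrightarrow> \<alpha> y" for y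
  proof (rule LIMSEQ_I)
    fix e :: real assume "0 < e"
    then obtain m where "\<forall>q\<in>range a. proj_le (a m) q \<longrightarrow> norm (q y - \<alpha> y) < e"
      using \<alpha>(3)[THEN spec, of y] by blast
    then show "\<exists>no. \<forall>n\<ge>no. norm (a n y - \<alpha> y) < e" using amono by blast
  qed
  have "(\<lambda>n. a n x - x) \<longlonglongrightarrow> 0"
    by (rule Lim_null_comparison[OF _ lim_inverse_n'[THEN LIMSEQ_Suc]])
      (rule always_eventually, intro allI less_imp_le a(2))
  then have "\<alpha> x = x" using LIMSEQ_unique[OF lim] by (simp add: LIM_zero_iff)
  \<comment> \<open>The join \<open>\<alpha>\<close> of the sequence may be smaller than
    \<open>s\<close>, so \<open>b\<close> is cut down to lie below \<open>\<alpha>\<close>; the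
    vector \<open>x\<close> survives.\<close>
  obtain b' where b': "b' \<in> \<P>" "\<And>x. b' x = x \<longleftrightarrow> b x = x \<and> \<alpha> x = x"
    using ex_proj_meet[OF b(1) \<alpha>(1)] by blast
  \<comment> \<open>The sequence is shifted by one to start at zero.\<close>
  define d where "d n = (case n of 0 \<Rightarrow> (\<lambda>x. 0) | Suc m \<Rightarrow> a m)" for n
  have "b' x = 0"
  proof (rule finite_sequence_meet[OF fin _ _ _ \<alpha>(1) _ _ b'(1)])
    show "d n \<in> \<P>" "proj_le (d n) (d (Suc n))" "proj_le (d n) \<alpha>" for n
      using proj_zero aP a(3) lattice.z_le \<alpha>(1,2) by (auto simp: d_def split: nat.split)
    show "d 0 y = 0" for y by (simp add: d_def)
    show "(\<lambda>n. d n y) \<longlonglongrightarrow> \<alpha> y" for y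
      by (rule LIMSEQ_imp_Suc) (simp add: d_def lim)
    show "proj_le b' \<alpha>" using b' \<alpha>(1) by (intro proj_leI) auto
    show "y = 0" if "b' y = y" "d n y = y" for n y
      using that b' triv[OF a(1)] by (cases n) (auto simp: d_def)
  qed
  then show False using b'(2)[of x] x \<open>\<alpha> x = x\<close> by simp
qed

text \<open>An eigenvector of the adjoint \<open>V\<close> is \<open>\<Sum>n. (1/2)\<^sup>n W\<^sup>n y\<close> with \<open>V y = 0\<close>.\<close>

lemma finite_if_finite_type:
  assumes ft: "finite_type \<P> proj_le"
  shows "finite_vNa M"
proof (rule ccontr)
  assume "\<not> finite_vNa M"
  then obtain E V W where E: "E \<in> \<P>" "E \<noteq> id" and VW: "V \<in> M" "W \<in> M"
    and adj: "\<And>x y. inner (V x) y = inner x (W y)"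
    and "W \<circ> V = E" "V \<circ> W = id"
    unfolding finite_vNa_def mvn_equiv_def is_adjoint_def by blast
  then have WV: "\<And>x. W (V x) = E x" and inv: "\<And>x. V (W x) = x"
    by (auto simp: fun_eq_iff)
  note linV = mem_linear[OF VW(1)] and linW = mem_linear[OF VW(2)]
  have normW: "norm (W x) = norm x" for x
    using adj[of "W x" x] inv[of x] by (simp add: norm_eq_sqrt_inner)
  have normV: "norm (V x) \<le> norm x" for x
    using proj_norm_le[OF E(1), of x] normW[of "V x"] by (simp add: WV)
  have invn: "(V ^^ n) ((W ^^ n) x) = x" for n x
    by (induction n arbitrary: x) (simp_all add: funpow_swap1 inv)
  have adjn: "inner ((V ^^ n) x) y = inner x ((W ^^ n) y)" for n x y
    by (induction n arbitrary: x y) (simp_all add: adj funpow_swap1)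
  have adjn': "inner ((W ^^ n) x) y = inner x ((V ^^ n) y)" for n x y
    using adjn[of n y x] by (simp add: inner_commute)
  have linVn: "linear (V ^^ n)" and linWn: "linear (W ^^ n)" for n
    by (intro mem_linear mem_funpow VW)+
  have normWn: "norm ((W ^^ n) x) = norm x" for n x by (induction n) (simp_all add: normW)
  \<comment> \<open>The projection onto the kernel of \<open>V ^^ n\<close>, where \<open>W\<close>
    is the proper isometry and \<open>V\<close> its adjoint.\<close>
  define a where "a n x = x - (W ^^ n) ((V ^^ n) x)" for n x
  have a: "a n \<in> \<P>" for n
  proof -
    have "(\<lambda>x. (W ^^ n) ((V ^^ n) x)) \<in> \<P>"
      by (rule projI) (simp_all add: mem_comp mem_funpow VW invn adjn adjn')
    then show ?thesis unfolding a_def[abs_def] by (rule proj_compl)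
  qed
  have afix: "a n x = x \<longleftrightarrow> (V ^^ n) x = 0" for n x
  proof
    assume "a n x = x"
    then have "(V ^^ n) ((W ^^ n) ((V ^^ n) x)) = (V ^^ n) 0" by (simp add: a_def)
    then show "(V ^^ n) x = 0" by (simp add: invn linear_0[OF linVn])
  qed (simp add: a_def linear_0[OF linWn])
  have amono: "proj_le (a m) (a n)" if "m \<le> n" for m n
  proof (rule proj_leI[OF a a])
    fix x assume "a m x = x"
    moreover have "(V ^^ n) x = (V ^^ (n - m)) ((V ^^ m) x)"
      using that by (simp flip: funpow_add[THEN fun_cong, unfolded o_apply])
    ultimately show "a n x = x" by (simp add: afix linear_0[OF linVn])
  qed
  have dir: "\<forall>p\<in>range a. \<forall>q\<in>range a. \<exists>r\<in>range a. proj_le p r \<and> proj_le q r"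
  proof clarify
    fix m n
    show "\<exists>r\<in>range a. proj_le (a m) r \<and> proj_le (a n) r"
      using amono[of m "max m n"] amono[of n "max m n"] by auto
  qed
  have rangea: "range a \<subseteq> \<P>" "range a \<noteq> {}" using a by auto
  obtain s where s: "s \<in> \<P>" "\<forall>p\<in>range a. proj_le p s"
    "\<forall>u\<in>\<P>. (\<forall>p\<in>range a. proj_le p u) \<longrightarrow> proj_le s u"
    using ex_directed_sup[OF rangea dir] by (elim bexE conjE)

  define T where "T x = V x - (1/2) *\<^sub>R x" for x
  \<comment> \<open>\<open>A\<close> is a multiple of the adjoint of \<open>T\<close> composed with
    \<open>T\<close>, so its kernel is the eigenspace of \<open>V\<close> for 1/2. As
    \<open>T\<close> has norm at most 3/2, the factor 4/9 keeps \<open>A\<close> below 1.\<close>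
  define A where "A x = (4/9) *\<^sub>R (W (T x) - (1/2) *\<^sub>R T x)" for x
  have Ainner: "inner (A x) y = (4/9) * inner (T x) (T y)" for x y
    using adj[of y "T x"] by (simp add: A_def T_def[of y] inner_diff_left inner_diff_right inner_commute)
  have TM: "T \<in> M" unfolding T_def[abs_def] by (intro mem_intros VW)
  have "A \<in> M" unfolding A_def[abs_def] by (intro mem_intros mem_comp[OF VW(2)] TM)
  moreover have "inner (A x) y = inner x (A y)" for x y
    using Ainner[of x y] Ainner[of y x] by (simp add: inner_commute)
  moreover have "0 \<le> inner (A x) x" for x by (simp add: Ainner)
  moreover have "inner (A x) x \<le> inner x x" for x
  proof -
    have "norm (T x) \<le> 3/2 * norm x"
      using norm_triangle_ineq4[of "V x" "(1/2) *\<^sub>R x"] normV[of x] by (simp add: T_def)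
    then have "(norm (T x))\<^sup>2 \<le> (3/2 * norm x)\<^sup>2" by (simp add: power_mono)
    then show ?thesis by (simp add: Ainner power_mult_distrib power_divide flip: power2_norm_eq_inner)
  qed
  ultimately obtain b where b: "b \<in> \<P>" "\<And>x. b x = x \<longleftrightarrow> A x = 0"
    by (rule ex_kernel_proj) blast
  have bfix: "b x = x \<longleftrightarrow> V x = (1/2) *\<^sub>R x" for x
  proof
    assume "b x = x"
    then show "V x = (1/2) *\<^sub>R x" using Ainner[of x x] b(2) by (simp add: T_def)
  next
    assume "V x = (1/2) *\<^sub>R x"
    then show "b x = x" using b(2) by (simp add: A_def T_def linear_0[OF linW])
  qed
  have eigen: "(V ^^ n) x = (1/2) ^ n *\<^sub>R x" if "b x = x" for n x
    using that unfolding bfix by (induction n) (simp_all add: linear_scale[OF linV])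

  have "proj_le b s"
  proof (rule proj_leI[OF b(1) s(1)])
    fix x assume x: "b x = x"
    \<comment> \<open>The distance from \<open>x\<close> to \<open>s\<close> is at most that to
      \<open>a n\<close>, which equals the norm of \<open>(V ^^ n) x\<close>.\<close>
    have "norm (x - s x) \<le> (1/2) ^ n * norm x" for n
    proof -
      have "s (a n x) = a n x" using s(2) proj_le_iff[OF a s(1)] by blast
      then have "x - s x = (x - a n x) - s (x - a n x)" using s(1) by (simp add: proj_simps)
      then have "norm (x - s x) \<le> norm (x - a n x)"
        using proj_norm_le[OF proj_compl[OF s(1)], of "x - a n x"] by (simp only:)
      also have "\<dots> = norm ((V ^^ n) x)" by (simp add: a_def normWn)
      finally show ?thesis by (simp add: eigen[OF x])
    qed
    moreover have "(\<lambda>n. (1/2) ^ n * norm x) \<longlonglongrightarrow> 0 * norm x"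
      by (intro tendsto_intros LIMSEQ_realpow_zero) auto
    ultimately have "norm (x - s x) \<le> 0"
      using LIMSEQ_le_const[of "\<lambda>n. (1/2) ^ n * norm x" 0 "norm (x - s x)"] by auto
    then show "s x = x" by simp
  qed
  moreover have "b \<noteq> (\<lambda>x. 0)"
  proof
    assume b0: "b = (\<lambda>x. 0)"
    obtain z where z: "E z \<noteq> z" using E(2) by (auto simp: fun_eq_iff)
    define y where "y = z - E z"
    have "V (E z) = V z" using inv by (simp flip: WV)
    then have y: "V y = 0" "y \<noteq> 0" using z by (auto simp: y_def linear_diff[OF linV])
    define f where "f n = (1/2) ^ n *\<^sub>R (W ^^ n) y" for n
    have "convergent (\<lambda>n. \<Sum>i<n. f i)"
    proof (rule convergent_of_square_increments_seq)
      fix m n :: nat assume mn: "m \<le> n"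
      \<comment> \<open>The partial sums of the geometric series. Their differences are at most 2,
        so squaring leaves a bound linear in \<open>t n - t m\<close>, as the potential
        requires.\<close>
      define t :: "nat \<Rightarrow> real" where "t k = 2 - 2 * (1/2) ^ k" for k
      have "norm ((\<Sum>i<n. f i) - (\<Sum>i<m. f i)) \<le> (t n - t m) * norm y"
        using mn
      proof (induction n rule: dec_induct)
        case (step n)
        have "norm ((\<Sum>i<n. f i) - (\<Sum>i<m. f i) + f n) \<le> (t n - t m) * norm y + norm (f n)"
          using norm_triangle_ineq step.IH by (rule order_trans[OF _ add_right_mono])
        then show ?case by (simp add: f_def normWn t_def algebra_simps)
      qed simp
      then have "(norm ((\<Sum>i<n. f i) - (\<Sum>i<m. f i)))\<^sup>2 \<le> ((t n - t m) * norm y)\<^sup>2"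
        by (rule power_mono) simp
      also have "\<dots> = (t n - t m) * (t n - t m) * (norm y)\<^sup>2" by (simp add: power2_eq_square)
      also have "\<dots> \<le> 2 * (t n - t m) * (norm y)\<^sup>2"
      proof (intro mult_right_mono)
        have "(1/2 :: real) ^ m \<le> 1" "(0 :: real) \<le> (1/2) ^ n" by (auto intro: power_le_one)
        then show "t n - t m \<le> 2" unfolding t_def by linarith
        show "0 \<le> t n - t m" using mn by (simp add: t_def power_decreasing)
      qed simp
      finally show "(norm ((\<Sum>i<n. f i) - (\<Sum>i<m. f i)))\<^sup>2
          \<le> 2 * (2 - 2 * (1/2) ^ n) * (norm y)\<^sup>2 - 2 * (2 - 2 * (1/2) ^ m) * (norm y)\<^sup>2"
        by (simp add: t_def algebra_simps)
    next
      fix n show "2 * (2 - 2 * (1/2) ^ n) * (norm y)\<^sup>2 \<le> 4 * (norm y)\<^sup>2"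
        by (intro mult_right_mono) auto
    qed
    then have sumf: "summable f" by (simp add: summable_iff_convergent)
    have "(\<Sum>n. f (Suc n)) = (\<Sum>n. (1/2) *\<^sub>R W (f n))"
      by (simp add: f_def linear_scale[OF linW])
    also have "\<dots> = (1/2) *\<^sub>R W (suminf f)"
      using bounded_linear.suminf[OF mem_bounded_linear[OF mem_scaleR[OF VW(2), of "1/2"]] sumf] by simp
    \<comment> \<open>Shifting the series by one term is applying half of \<open>W\<close>; as
      \<open>V W = 1\<close> and \<open>V y = 0\<close>, applying \<open>V\<close> yields the
      eigenvalue equation.\<close>
    finally have eq: "suminf f = (1/2) *\<^sub>R W (suminf f) + y"
      using suminf_split_head[OF sumf] by (simp add: f_def)
    have "V (suminf f) = V ((1/2) *\<^sub>R W (suminf f) + y)" using eq by simp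
    also have "\<dots> = (1/2) *\<^sub>R suminf f" by (simp add: linear_add[OF linV] linear_scale[OF linV] inv y)
    finally have "b (suminf f) = suminf f" by (simp add: bfix)
    then have "suminf f = 0" by (simp add: b0)
    then show False using eq y by (simp add: linear_0[OF linW])
  qed
  ultimately obtain p where "p \<in> range a" "lat_meet \<P> proj_le b p \<noteq> (\<lambda>x. 0)"
    using lattice.finite_typeD[OF ft rangea dir s b(1)] by blast
  then obtain n x where nx: "b x = x" "a n x = x" "x \<noteq> 0"
    using meet_eq_zero_iff[OF b(1) a] by blast
  \<comment> \<open>Here \<open>(V ^^ n) x\<close> is both zero and a nonzero multiple of
    \<open>x\<close>.\<close>
  then show False using eigen[OF nx(1), of n] by (simp add: afix)
qed

end

theorem theorem3p23:
  fixes J :: "'a::{real_inner,complete_space} \<Rightarrow> 'a"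
    and M :: "('a \<Rightarrow> 'a) set"
  assumes "von_neumann_algebra J M"
  shows "finite_type (projections M) proj_le \<longleftrightarrow> finite_vNa M"
proof -
  interpret von_neumann J M using assms by unfold_locales
  show ?thesis using finite_type_if_finite finite_if_finite_type by blast
qed

end
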